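(* Suppose the prior $\Pi$ has the Kullback–Leibler property, i.e. $\Pi(\{f : D(f,f_0)<\varepsilon\})>0$ for every $\varepsilon>0$. Let $A\subseteq\Omega$ be a (measurable) set of densities, let $L_n=\int_A R_n(f)\,\Pi(df)$, and suppose that $$\sum_{n\ge 1} n^{-2}\operatorname{Var}\{\log(L_n/L_{n-1})\}<\infty$$ and $$\liminf_{n\to\infty} D(f_{nA},f_0)>0\qquad\text{a.s. } [F_0^\infty].$$ Then $$\Pi^n(A)\to 0\qquad\text{a.s. } [F_0^\infty]\text{ as } n\to\infty.$$
   Context: Let $X_1,X_2,\ldots$, taking values in $(\mathscr{X},\mathscr{B})$, be i.i.d. with fixed density $f_0$ (with respect to Lebesgue measure) and distribution $F_0$; $F_0^\infty$ is the infinite product measure, and all almost sure statements and variances refer to it. $\Omega$ is the space of density functions (with respect to Lebesgue measure) on $(\mathscr{X},\mathscr{B})$, and the prior $\Pi$ is a probability distribution on $\Omega$. Put $R_n(f)=\prod_{i=1}^n f(X_i)/f_0(X_i)$ (with $R_0\equiv 1$). The posterior is $$\Pi^n(A)=\frac{\int_A R_n(f)\,\Pi(df)}{\int R_n(f)\,\Pi(df)} .$$ With $L_n=\int_A R_n(f)\,\Pi(df)$, so $L_0=\Pi(A)$, the predictive density with posterior restricted and normalized to $A$ is $$f_{nA}(x)=\int f(x)\,\Pi_A^n(df)=\frac{\int_A f(x)R_n(f)\,\Pi(df)}{L_n}.$$ It is understood that $A$ is such that this is well defined, i.e. $L_n>0$ a.s. for all $n\ge 0$. The Kullback–Leibler divergence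 is $D(f,f_0)=\int f_0\log(f_0/f)$. *)

theory Defs
  imports "HOL-Probability.Probability"
begin

abbreviation lborel_on :: "'a::euclidean_space set \<Rightarrow> 'a measure"
  where "lborel_on X \<equiv> restrict_space lborel X"

definition densities :: "'a measure \<Rightarrow> ('a \<Rightarrow> real) set"
  where "densities M =
    {f \<in> borel_measurable M. (\<forall>x\<in>space M. 0 \<le> f x) \<and> (\<integral>\<^sup>+ x. ennreal (f x) \<partial>M) = 1}"

text \<open>A prior is a probability measure whose space is a set of densities. The evaluation map is
  required to be jointly measurable, so that the integrals over \<open>f\<close> of expressions in \<open>f x\<close> and
  \<open>f (X\<^sub>i)\<close> make sense and Fubini applies.
  The space is not required to contain every density function: no \<open>\<sigma>\<close>-algebra on the
  set of all pointwise-defined Borel densities makes evaluation jointly measurable (already on the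
  unit interval). The usual space of densities modulo a.e. equality corresponds to choosing one
  version of each density, in a jointly measurable way.\<close>

definition is_prior :: "'a measure \<Rightarrow> ('a \<Rightarrow> real) measure \<Rightarrow> bool"
  where "is_prior M Q \<longleftrightarrow>
    prob_space Q \<and> space Q \<subseteq> densities M \<and>
    (\<lambda>(f, x). f x) \<in> borel_measurable (Q \<Otimes>\<^sub>M M)"

text \<open>\<open>D(f, f0) = \<integral> f0 log (f0 / f)\<close> as an extended real. The constant \<^const>\<open>KL_divergence\<close> is
  real-valued and returns 0 when the integral is infinite, which would make densities at infinite
  distance look close to \<open>f0\<close>. For \<open>f\<close>, \<open>f0\<close> densities the negative part has integral at most 1, so
  the difference below is never \<open>\<infinity> - \<infinity>\<close>.\<close>

definition kl_integrand :: "('a \<Rightarrow> real) \<Rightarrow> ('a \<Rightarrow> real) \<Rightarrow> 'a \<Rightarrow> ereal"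
  where "kl_integrand f f0 x =
    (if f0 x = 0 then 0 else if f x = 0 then \<infinity> else ereal (f0 x * ln (f0 x / f x)))"

text \<open>\<^const>\<open>e2ennreal\<close> maps negative arguments to 0, so the two integrals are those of the
  positive and of the negative part.\<close>

definition kl_div :: "'a measure \<Rightarrow> ('a \<Rightarrow> real) \<Rightarrow> ('a \<Rightarrow> real) \<Rightarrow> ereal"
  where "kl_div M f f0 =
    enn2ereal (\<integral>\<^sup>+ x. e2ennreal (kl_integrand f f0 x) \<partial>M) -
    enn2ereal (\<integral>\<^sup>+ x. e2ennreal (- kl_integrand f f0 x) \<partial>M)"

definition KL_property :: "'a measure \<Rightarrow> ('a \<Rightarrow> real) measure \<Rightarrow> ('a \<Rightarrow> real) \<Rightarrow> bool"
  where "KL_property M Q f0 \<longleftrightarrow>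
    (\<forall>\<epsilon>::real. \<epsilon> > 0 \<longrightarrow> emeasure Q {f \<in> space Q. kl_div M f f0 < ereal \<epsilon>} > 0)"

text \<open>The product measure \<open>F\<^sub>0\<^sup>\<infinity>\<close>. A sample point \<open>\<omega>\<close> is the sequence of observations, the \<open>i\<close>-th
  observation being \<open>\<omega> i\<close> for \<open>i \<ge> 1\<close>.\<close>

definition sample_measure :: "'a measure \<Rightarrow> ('a \<Rightarrow> real) \<Rightarrow> (nat \<Rightarrow> 'a) measure"
  where "sample_measure M f0 = (\<Pi>\<^sub>M i\<in>{1..}. density M f0)"

definition lik_ratio :: "('a \<Rightarrow> real) \<Rightarrow> nat \<Rightarrow> (nat \<Rightarrow> 'a) \<Rightarrow> ('a \<Rightarrow> real) \<Rightarrow> real"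
  where "lik_ratio f0 n \<omega> f = (\<Prod>i=1..n. f (\<omega> i) / f0 (\<omega> i))"

definition int_lik ::
    "('a \<Rightarrow> real) measure \<Rightarrow> ('a \<Rightarrow> real) \<Rightarrow> ('a \<Rightarrow> real) set \<Rightarrow> nat \<Rightarrow> (nat \<Rightarrow> 'a) \<Rightarrow> real"
  where "int_lik Q f0 A n \<omega> = (LINT f:A|Q. lik_ratio f0 n \<omega> f)"

definition posterior ::
    "('a \<Rightarrow> real) measure \<Rightarrow> ('a \<Rightarrow> real) \<Rightarrow> nat \<Rightarrow> (nat \<Rightarrow> 'a) \<Rightarrow> ('a \<Rightarrow> real) set \<Rightarrow> real"
  where "posterior Q f0 n \<omega> A =
    (LINT f:A|Q. lik_ratio f0 n \<omega> f) / (LINT f|Q. lik_ratio f0 n \<omega> f)"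

definition predictive ::
    "('a \<Rightarrow> real) measure \<Rightarrow> ('a \<Rightarrow> real) \<Rightarrow> ('a \<Rightarrow> real) set \<Rightarrow> nat \<Rightarrow> (nat \<Rightarrow> 'a) \<Rightarrow> 'a \<Rightarrow> real"
  where "predictive Q f0 A n \<omega> x =
    (LINT f:A|Q. f x * lik_ratio f0 n \<omega> f) / int_lik Q f0 A n \<omega>"

text \<open>Variance with values in \<open>[0, \<infinity>]\<close>; it is \<open>\<infinity>\<close> whenever the (measurable) variable is not square
  integrable. In particular, for a non-integrable variable the Bochner integral is 0 and the outer
  integral is infinite.\<close>

definition ext_variance :: "'b measure \<Rightarrow> ('b \<Rightarrow> real) \<Rightarrow> ennreal"
  where "ext_variance P Y = (\<integral>\<^sup>+ \<omega>. ennreal ((Y \<omega> - (LINT \<omega>'|P. Y \<omega>'))\<^sup>2) \<partial>P)"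

end

theory Submission
  imports Defs
begin

text \<open>
  Write \<open>L n\<close> for the integral of the likelihood ratio over \<open>A\<close> and \<open>I n\<close> for the integral over
  the whole prior, so that the posterior probability of \<open>A\<close> is \<open>L n / I n\<close>. The numerator
  decays exponentially, the denominator more slowly than at any exponential rate.

  \<^emph>\<open>Numerator.\<close> The ratio \<open>L (n + 1) / L n\<close> is the predictive density restricted to \<open>A\<close>, divided
  by \<open>f0\<close>, at the observation \<open>n + 1\<close>. Given the first \<open>n\<close> observations, the conditional mean of
  its logarithm is therefore minus the divergence \<open>D n\<close> of the predictive density from \<open>f0\<close>
  (\<open>kl_div_predictive\<close>). The sums \<open>ln (L n / L 0) + (D 0 + ... + D (n - 1))\<close> form a martingale, whose
  increments have second moments bounded by the variances of the hypothesis. A strong law for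
  martingales (\<open>strong_law\<close>, applied in \<open>strong_law_one_step_mean\<close>) shows that they are \<open>o(n)\<close>.
  Since \<open>D n\<close> is eventually bounded away from 0, \<open>L n\<close> decays exponentially
  (\<open>exponential_decay\<close>). The strong law comes from Kolmogorov's maximal inequality on dyadic
  blocks and the Borel--Cantelli lemma.

  \<^emph>\<open>Denominator.\<close> For a density \<open>f\<close> with divergence less than \<open>e\<close>, the law of large numbers
  prevents the likelihood ratio from decaying faster than \<open>exp (- n * e)\<close>
  (\<open>likelihood_lower_bound\<close>). Such densities have positive prior probability, so the same holds
  for \<open>I n\<close>, for every \<open>e > 0\<close> (\<open>marginal_likelihood_lower_bound\<close>). The logarithm of \<open>f0 / f\<close> need
  not have a variance here; the law of large numbers is used only in the form that sums of i.i.d.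
  variables with negative mean are bounded above (\<open>partial_sums_bounded_above\<close>).

  In both halves, independence enters through the fact that redrawing a single observation
  preserves the product measure (\<open>distr_resample\<close>).
\<close>

section \<open>A strong law for martingale differences\<close>

lemma integrable_mult_square_integrable:
  fixes f g :: "'a \<Rightarrow> real"
  assumes [measurable]: "f \<in> borel_measurable M" "g \<in> borel_measurable M"
    and "integrable M (\<lambda>x. (f x)\<^sup>2)" "integrable M (\<lambda>x. (g x)\<^sup>2)"
  shows "integrable M (\<lambda>x. f x * g x)"
proof (rule Bochner_Integration.integrable_bound)
  show "integrable M (\<lambda>x. (f x)\<^sup>2 + (g x)\<^sup>2)" using assms by simp
  have "\<bar>a * b\<bar> \<le> a\<^sup>2 + b\<^sup>2" for a b :: real
  proof -
    have "0 \<le> \<bar>a * b\<bar>" by simp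
    moreover have "2 * \<bar>a * b\<bar> \<le> a\<^sup>2 + b\<^sup>2"
      using sum_squares_bound[of "\<bar>a\<bar>" "\<bar>b\<bar>"] by (simp add: abs_mult)
    ultimately show ?thesis by linarith
  qed
  then show "AE x in M. norm (f x * g x) \<le> norm ((f x)\<^sup>2 + (g x)\<^sup>2)" by simp
qed measurable

text \<open>Martingale differences with finite second moments, indexed so that \<open>d n\<close> is
  observed at time \<open>n + 1\<close> and has conditional mean zero given the information \<open>F n\<close> available
  just before. The partial sum \<open>S n\<close> is therefore known at time \<open>n\<close>.\<close>

locale square_martingale_difference = prob_space M for M :: "'a measure" +
  fixes F :: "nat \<Rightarrow> 'a measure" and d :: "nat \<Rightarrow> 'a \<Rightarrow> real"
  assumes subalg: "\<And>n. subalgebra M (F n)"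
    and filtration: "\<And>m n. m \<le> n \<Longrightarrow> sets (F m) \<subseteq> sets (F n)"
    and adapted: "\<And>n. d n \<in> borel_measurable (F (Suc n))"
    and square_integrable: "\<And>n. integrable M (\<lambda>x. (d n x)\<^sup>2)"
    and centered: "\<And>n. AE x in M. real_cond_exp M (F n) (d n) x = 0"
begin

definition S :: "nat \<Rightarrow> 'a \<Rightarrow> real" where "S n x = (\<Sum>i<n. d i x)"

lemma measurable_filtration:
  assumes "f \<in> borel_measurable (F m)" "m \<le> n" shows "f \<in> borel_measurable (F n)"
proof -
  have "subalgebra (F n) (F m)"
    using subalg[of n] subalg[of m] filtration[OF assms(2)] by (simp add: subalgebra_def)
  then show ?thesis using assms(1) by (rule measurable_from_subalg)
qed

lemma measurable_d[measurable]: "d n \<in> borel_measurable M"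
  using adapted subalg by (rule measurable_from_subalg[rotated])

lemma measurable_S_filtration: "m \<le> n \<Longrightarrow> S m \<in> borel_measurable (F n)"
  unfolding S_def
  by (intro borel_measurable_sum measurable_filtration[OF adapted]) auto

lemma measurable_S[measurable]: "S n \<in> borel_measurable M"
  using measurable_S_filtration[OF order_refl] subalg by (rule measurable_from_subalg[rotated])

lemma square_integrable_S: "integrable M (\<lambda>x. (S n x)\<^sup>2)"
proof (induction n)
  case (Suc n)
  have "integrable M (\<lambda>x. (S n x)\<^sup>2 + 2 * (S n x * d n x) + (d n x)\<^sup>2)"
    using Suc square_integrable integrable_mult_square_integrable[OF _ _ Suc square_integrable, of n]
    by (intro Bochner_Integration.integrable_add integrable_mult_right) simp_all
  then show ?case by (simp add: S_def power2_sum mult_ac add_ac)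
qed (simp add: S_def)

text \<open>Conditioning on \<open>F n\<close> pulls \<open>f\<close> out of the expectation and leaves the conditional mean
  of \<open>d n\<close>. With \<open>f = S n\<close>, the cross terms in the square of a partial sum vanish.\<close>

lemma orthogonal:
  assumes f: "f \<in> borel_measurable (F n)" "integrable M (\<lambda>x. (f x)\<^sup>2)"
  shows "(\<integral>x. f x * d n x \<partial>M) = 0"
proof -
  interpret finite_measure_subalgebra M "F n" by standard (rule subalg)
  have "f \<in> borel_measurable M" using measurable_from_subalg[OF subalg f(1)] .
  then have "integrable M (\<lambda>x. f x * d n x)"
    using f(2) square_integrable by (intro integrable_mult_square_integrable) simp_all
  then have "(\<integral>x. f x * d n x \<partial>M) = (\<integral>x. f x * real_cond_exp M (F n) (d n) x \<partial>M)"
    using f(1) by (intro real_cond_exp_intg(2)[symmetric]) simp_all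
  also have "\<dots> = (\<integral>x. 0 \<partial>M)"
  proof (rule integral_cong_AE)
    show "(\<lambda>x. f x * real_cond_exp M (F n) (d n) x) \<in> borel_measurable M"
      using \<open>f \<in> borel_measurable M\<close> by simp
  qed (use centered[of n] in auto)
  finally show ?thesis by simp
qed

lemma variance_S: "(\<integral>x. (S n x)\<^sup>2 \<partial>M) = (\<Sum>i<n. \<integral>x. (d i x)\<^sup>2 \<partial>M)"
proof (induction n)
  case (Suc n)
  have int: "integrable M (\<lambda>x. S n x * d n x)"
    by (intro integrable_mult_square_integrable square_integrable square_integrable_S) simp_all
  have "(\<integral>x. (S (Suc n) x)\<^sup>2 \<partial>M) = (\<integral>x. (S n x)\<^sup>2 + 2 * (S n x * d n x) + (d n x)\<^sup>2 \<partial>M)"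
    by (simp add: S_def power2_sum mult_ac add_ac)
  also have "\<dots> = (\<integral>x. (S n x)\<^sup>2 \<partial>M) + 2 * (\<integral>x. S n x * d n x \<partial>M) + (\<integral>x. (d n x)\<^sup>2 \<partial>M)"
    using int square_integrable square_integrable_S by simp
  finally show ?case
    using Suc orthogonal[OF measurable_S_filtration[OF order_refl] square_integrable_S[of n]] by simp
qed (simp add: S_def)

lemma chebyshev:
  assumes "a > 0"
  shows "prob {x\<in>space M. a \<le> \<bar>S n x\<bar>} \<le> (\<Sum>i<n. \<integral>x. (d i x)\<^sup>2 \<partial>M) / a\<^sup>2"
proof -
  have "{x\<in>space M. a \<le> \<bar>S n x\<bar>} = {x\<in>space M. a\<^sup>2 \<le> (S n x)\<^sup>2}"
    using assms by (auto simp: abs_le_square_iff[of a, symmetric])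
  then show ?thesis
    using integral_Markov_inequality_measure[OF square_integrable_S[of n] sets.top, of "a\<^sup>2"] assms
    by (simp add: variance_S)
qed

text \<open>Switching off all increments after the first time that \<open>\<bar>S j\<bar>\<close> reaches the level
  \<open>a\<close> preserves the martingale property, because whether this has happened by time \<open>n\<close> is
  decided by \<open>F n\<close>, before \<open>d n\<close> is observed.\<close>

lemma stopped:
  "square_martingale_difference M F (\<lambda>i x. if \<forall>j\<le>i. \<bar>S j x\<bar> < a then d i x else 0)"
proof
  fix n
  let ?g = "\<lambda>x. if \<forall>j\<le>n. \<bar>S j x\<bar> < a then 1 else 0 :: real"
  have g: "?g \<in> borel_measurable (F n)"
  proof -
    have [measurable]: "S j \<in> borel_measurable (F n)" if "j \<in> {..n}" for j
      using measurable_S_filtration that by simp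
    have "Measurable.pred (F n) (\<lambda>x. \<forall>j\<in>{..n}. \<bar>S j x\<bar> < a)" by measurable
    then have "Measurable.pred (F n) (\<lambda>x. \<forall>j\<le>n. \<bar>S j x\<bar> < a)" by (simp add: Ball_def)
    then show ?thesis by measurable
  qed
  have gM [measurable]: "?g \<in> borel_measurable M" using measurable_from_subalg[OF subalg g] .
  have eq: "(\<lambda>x. if \<forall>j\<le>n. \<bar>S j x\<bar> < a then d n x else 0) = (\<lambda>x. ?g x * d n x)"
    by (rule ext) auto
  show "(\<lambda>x. if \<forall>j\<le>n. \<bar>S j x\<bar> < a then d n x else 0) \<in> borel_measurable (F (Suc n))"
    unfolding eq by (intro borel_measurable_times measurable_filtration[OF g, of "Suc n"] adapted) simp
  show "integrable M (\<lambda>x. (if \<forall>j\<le>n. \<bar>S j x\<bar> < a then d n x else 0)\<^sup>2)"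
  proof (rule Bochner_Integration.integrable_bound[OF square_integrable[of n]])
    have "(\<lambda>x. (?g x * d n x)\<^sup>2) \<in> borel_measurable M"
      by (intro borel_measurable_power borel_measurable_times gM measurable_d)
    then show "(\<lambda>x. (if \<forall>j\<le>n. \<bar>S j x\<bar> < a then d n x else 0)\<^sup>2) \<in> borel_measurable M"
      using eq by (metis (no_types, lifting) ext)
  qed auto
  interpret finite_measure_subalgebra M "F n" by standard (rule subalg)
  have "integrable M (d n)" by (rule square_integrable_imp_integrable[OF _ square_integrable]) simp
  then have "integrable M (\<lambda>x. ?g x * d n x)"
    by (rule Bochner_Integration.integrable_bound) (auto intro!: borel_measurable_times gM)
  then have "AE x in M. real_cond_exp M (F n) (\<lambda>x. ?g x * d n x) x = ?g x * real_cond_exp M (F n) (d n) x"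
    by (intro real_cond_exp_mult g) simp_all
  then show "AE x in M. real_cond_exp M (F n)
      (\<lambda>x. if \<forall>j\<le>n. \<bar>S j x\<bar> < a then d n x else 0) x = 0"
    unfolding eq using centered[of n] by eventually_elim simp
qed (use subalg filtration in auto)

text \<open>If some partial sum up to time \<open>n\<close> reaches the level \<open>a\<close>, then the stopped martingale
  stays at a value of modulus at least \<open>a\<close> and still has it at time \<open>n\<close>. So the maximum
  exceeds \<open>a\<close> only if the stopped martingale does at the single time \<open>n\<close>, and Chebyshev's
  inequality applies; stopping only decreases the second moments of the increments.\<close>

lemma kolmogorov_maximal_inequality:
  assumes "a > 0"
  shows "prob {x\<in>space M. \<exists>k\<le>n. a \<le> \<bar>S k x\<bar>} \<le> (\<Sum>i<n. \<integral>x. (d i x)\<^sup>2 \<partial>M) / a\<^sup>2"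
proof -
  let ?e = "\<lambda>i x. if \<forall>j\<le>i. \<bar>S j x\<bar> < a then d i x else 0"
  interpret T: square_martingale_difference M F ?e by (rule stopped)
  \<comment> \<open>\<open>T.S\<close> follows \<open>S\<close> up to and including the crossing time and is constant from then on.\<close>
  have T_eq: "T.S k x = S k x" if "\<forall>j<k. \<bar>S j x\<bar> < a" for k x
    unfolding T.S_def using that by (subst S_def) (auto intro!: sum.cong)
  have T_const: "T.S n x = T.S k x" if "a \<le> \<bar>S k x\<bar>" "k \<le> n" for k x
    using that(2)
  proof (induction rule: dec_induct)
    case (step m) then show ?case using that(1) by (fastforce simp: T.S_def)
  qed simp
  have "{x\<in>space M. \<exists>k\<le>n. a \<le> \<bar>S k x\<bar>} \<subseteq> {x\<in>space M. a \<le> \<bar>T.S n x\<bar>}"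
  proof safe
    fix x k assume "k \<le> n" "a \<le> \<bar>S k x\<bar>"
    define m where "m = (LEAST k. a \<le> \<bar>S k x\<bar>)"
    have m: "a \<le> \<bar>S m x\<bar>" "m \<le> k" "\<forall>j<m. \<bar>S j x\<bar> < a"
      unfolding m_def using \<open>a \<le> \<bar>S k x\<bar>\<close>
      by (rule LeastI, rule Least_le) (use not_less_Least in force)
    then show "a \<le> \<bar>T.S n x\<bar>" using T_const[OF m(1)] T_eq[OF m(3)] \<open>k \<le> n\<close> by simp
  qed
  then have "prob {x\<in>space M. \<exists>k\<le>n. a \<le> \<bar>S k x\<bar>} \<le> prob {x\<in>space M. a \<le> \<bar>T.S n x\<bar>}"
    by (intro finite_measure_mono) measurable
  also have "\<dots> \<le> (\<Sum>i<n. \<integral>x. (?e i x)\<^sup>2 \<partial>M) / a\<^sup>2" using T.chebyshev[OF assms] .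
  also have "\<dots> \<le> (\<Sum>i<n. \<integral>x. (d i x)\<^sup>2 \<partial>M) / a\<^sup>2"
    by (intro divide_right_mono sum_mono integral_mono T.square_integrable square_integrable) auto
  finally show ?thesis .
qed

end

text \<open>The indices \<open>k\<close> with \<open>i < 2 ^ Suc k\<close> start where \<open>2 ^ Suc k\<close> is about \<open>i + 1\<close>, so the
  geometric sum is comparable with its first term, which is of order \<open>1 / (i + 1)\<^sup>2\<close>.\<close>

lemma sum_dyadic_le:
  "(\<Sum>k | k < K \<and> i < 2 ^ Suc k. (1/4::real) ^ k) \<le> 16 / 3 / (real (Suc i))\<^sup>2"
proof -
  define k0 where "k0 = (LEAST k. i < 2 ^ Suc k)"
  have "i < 2 ^ Suc i" using less_exp[of "Suc i"] by simp
  then have k0: "i < 2 ^ Suc k0" unfolding k0_def by (rule LeastI)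
  have "real (Suc i) \<le> 2 * 2 ^ k0"
  proof -
    have "Suc i \<le> 2 ^ Suc k0" using k0 by simp
    then show ?thesis by (metis of_nat_le_iff of_nat_numeral of_nat_power power_Suc)
  qed
  then have sq: "(real (Suc i))\<^sup>2 \<le> (2 * 2 ^ k0)\<^sup>2" by (intro power_mono) auto
  have "{k. k < K \<and> i < 2 ^ Suc k} \<subseteq> {k0..<k0 + K}"
    unfolding k0_def by (auto intro: Least_le)
  then have "(\<Sum>k | k < K \<and> i < 2 ^ Suc k. (1/4::real) ^ k) \<le> (\<Sum>k=k0..<k0 + K. (1/4) ^ k)"
    by (intro sum_mono2) auto
  also have "\<dots> = (1/4) ^ k0 * (\<Sum>k<K. (1/4) ^ k)"
    by (simp add: sum_distrib_left power_add atLeast0LessThan[symmetric]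
        sum.shift_bounds_nat_ivl[of _ 0 k0 K, simplified add_0] add.commute mult.commute)
  also have "(\<Sum>k<K. (1/4::real) ^ k) \<le> 4 / 3"
    by (simp add: sum_gp_strict)
  also have "(1/4) ^ k0 * (4/3) = 16 / 3 / (2 * 2 ^ k0 :: real)\<^sup>2"
    by (simp add: power2_eq_square power_divide field_simps flip: power_mult_distrib)
  also have "\<dots> \<le> 16 / 3 / (real (Suc i))\<^sup>2" using sq by (intro divide_left_mono) auto
  finally show ?thesis by (simp add: mult_left_mono)
qed

text \<open>The bounds that the maximal inequality gives on the dyadic blocks form a summable series:
  exchange the order of summation and apply the preceding estimate to each \<open>s i\<close>.\<close>

lemma summable_dyadic_blocks:
  fixes s :: "nat \<Rightarrow> real"
  assumes nonneg: "\<And>i. 0 \<le> s i" and summable: "summable (\<lambda>i. s i / (real (Suc i))\<^sup>2)"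
  shows "summable (\<lambda>k. (\<Sum>i<2 ^ Suc k. s i) / 4 ^ k)"
proof (rule summableI_nonneg_bounded)
  fix K
  let ?R = "{..<2 ^ Suc K :: nat}"
  have "(\<Sum>k<K. (\<Sum>i<2 ^ Suc k. s i) / 4 ^ k) =
      (\<Sum>k<K. \<Sum>i | i \<in> ?R \<and> i < 2 ^ Suc k. s i * (1/4) ^ k)"
  proof (intro sum.cong refl)
    fix k assume "k \<in> {..<K}"
    then have le: "(2::nat) ^ Suc k \<le> 2 ^ Suc K" by (intro power_increasing) auto
    have "{i. i \<in> ?R \<and> i < 2 ^ Suc k} = {..<2 ^ Suc k}"
      using le by (auto simp del: power_Suc intro: less_le_trans)
    then show "(\<Sum>i<2 ^ Suc k. s i) / 4 ^ k = (\<Sum>i | i \<in> ?R \<and> i < 2 ^ Suc k. s i * (1/4) ^ k)"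
      by (simp add: sum_divide_distrib power_divide)
  qed
  also have "\<dots> = (\<Sum>i\<in>?R. \<Sum>k | k \<in> {..<K} \<and> i < 2 ^ Suc k. s i * (1/4) ^ k)"
    by (intro sum.swap_restrict) auto
  also have "\<dots> = (\<Sum>i\<in>?R. s i * (\<Sum>k | k < K \<and> i < 2 ^ Suc k. (1/4) ^ k))"
    by (simp add: sum_distrib_left)
  also have "\<dots> \<le> (\<Sum>i\<in>?R. s i * (16 / 3 / (real (Suc i))\<^sup>2))"
    by (intro sum_mono mult_left_mono sum_dyadic_le nonneg)
  also have "\<dots> = 16 / 3 * (\<Sum>i\<in>?R. s i / (real (Suc i))\<^sup>2)"
    by (simp add: sum_distrib_left field_simps)
  also have "\<dots> \<le> 16 / 3 * (\<Sum>i. s i / (real (Suc i))\<^sup>2)"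
    using nonneg by (intro mult_left_mono sum_le_suminf summable) auto
  finally show "(\<Sum>k<K. (\<Sum>i<2 ^ Suc k. s i) / 4 ^ k) \<le> 16 / 3 * (\<Sum>i. s i / (real (Suc i))\<^sup>2)" .
qed (simp add: nonneg sum_nonneg)

context square_martingale_difference begin

text \<open>On the block \<open>2 ^ k \<le> n < 2 ^ Suc k\<close> the event \<open>\<bar>S n\<bar> \<ge> e * n\<close> forces the maximum of
  \<open>\<bar>S j\<bar>\<close> over \<open>j \<le> 2 ^ Suc k\<close> to be at least \<open>e * 2 ^ k\<close>. The probabilities of these events are
  summable, so by the Borel--Cantelli lemma almost surely only finitely many blocks are affected.\<close>

theorem strong_law:
  assumes "summable (\<lambda>n. (\<integral>x. (d n x)\<^sup>2 \<partial>M) / (real (Suc n))\<^sup>2)"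
  shows "AE x in M. (\<lambda>n. (\<Sum>i<n. d i x) / real n) \<longlonglongrightarrow> 0"
proof -
  have small: "AE x in M. \<forall>\<^sub>F n in sequentially. \<bar>S n x\<bar> < e * real n" if "e > 0" for e :: real
  proof -
    define B where "B k = {x\<in>space M. \<exists>n\<le>2 ^ Suc k. e * 2 ^ k \<le> \<bar>S n x\<bar>}" for k :: nat
    have [measurable]: "B k \<in> sets M" for k unfolding B_def by measurable
    have "prob (B k) \<le> (\<Sum>i<2 ^ Suc k. \<integral>x. (d i x)\<^sup>2 \<partial>M) / 4 ^ k / e\<^sup>2" for k
    proof -
      have "(e * 2 ^ k)\<^sup>2 = 4 ^ k * e\<^sup>2"
        by (simp add: power_mult_distrib flip: power_mult) (simp add: mult.commute[of k] power_mult)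
      then show ?thesis
        using kolmogorov_maximal_inequality[of "e * 2 ^ k" "2 ^ Suc k"] that
        by (simp add: B_def)
    qed
    then have "summable (\<lambda>k. prob (B k))"
      by (intro summable_comparison_test'[OF summable_divide[OF summable_dyadic_blocks[OF _ assms]]])
        auto
    then have "AE x in M. \<forall>\<^sub>F k in sequentially. x \<in> space M - B k"
      by (intro borel_cantelli_AE1) (auto simp: less_top[symmetric])
    then show ?thesis
    proof eventually_elim
      fix x assume "\<forall>\<^sub>F k in sequentially. x \<in> space M - B k"
      then obtain k0 where k0: "\<And>k. k0 \<le> k \<Longrightarrow> x \<in> space M - B k"
        by (auto simp: eventually_sequentially)
      show "\<forall>\<^sub>F n in sequentially. \<bar>S n x\<bar> < e * real n"
        unfolding eventually_sequentially
      proof (intro exI[of _ "2 ^ k0"] allI impI)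
        fix n :: nat assume n: "2 ^ k0 \<le> n"
        then have "n > 0" by (metis gr0I le_zero_eq power_eq_0_iff zero_neq_numeral)
        then obtain k where k: "2 ^ k \<le> n" "n < 2 ^ Suc k" using ex_power_ivl1[of 2 n] by auto
        have "(2::nat) ^ k0 < 2 ^ Suc k" using n k(2) by simp
        then have "k0 < Suc k" by (rule power_less_imp_less_exp[rotated]) simp
        then have "\<not> e * 2 ^ k \<le> \<bar>S n x\<bar>" using k0[of k] k(2) by (auto simp: B_def)
        moreover have "e * 2 ^ k \<le> e * real n"
          using k(1) \<open>e > 0\<close> by (metis mult_left_mono less_imp_le of_nat_le_iff of_nat_numeral of_nat_power)
        ultimately show "\<bar>S n x\<bar> < e * real n" by simp
      qed
    qed
  qed
  have "AE x in M. \<forall>m. \<forall>\<^sub>F n in sequentially. \<bar>S n x\<bar> < 1 / real (Suc m) * real n"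
    unfolding AE_all_countable by (intro allI small) simp
  then show ?thesis
  proof eventually_elim
    fix x assume *: "\<forall>m. \<forall>\<^sub>F n in sequentially. \<bar>S n x\<bar> < 1 / real (Suc m) * real n"
    show "(\<lambda>n. (\<Sum>i<n. d i x) / real n) \<longlonglongrightarrow> 0"
    proof (rule tendstoI)
      fix r :: real assume "r > 0"
      then obtain m where m: "1 / real (Suc m) < r" using nat_approx_posE by blast
      show "\<forall>\<^sub>F n in sequentially. dist ((\<Sum>i<n. d i x) / real n) 0 < r"
        using *[rule_format, of m] eventually_gt_at_top[of 0]
      proof eventually_elim
        case (elim n)
        then have "\<bar>S n x\<bar> / real n < 1 / real (Suc m)" by (simp add: field_simps)
        then show ?case using m by (simp add: S_def)
      qed
    qed
  qed
qed

end

section \<open>Sequences of independent observations\<close>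

text \<open>Sample points are indexed from 1 and are \<open>undefined\<close> at index 0; the restriction keeps the
  shifted sequence in the same product space.\<close>

definition shift :: "(nat \<Rightarrow> 'a) \<Rightarrow> nat \<Rightarrow> 'a"
  where "shift \<omega> = (\<lambda>i\<in>{1..}. \<omega> (Suc i))"

text \<open>This is the maximum of 0 and of the partial sums of \<open>Z (\<omega> 1), ..., Z (\<omega> n)\<close>. The
  recursion through the shift, rather than through the last observation, is the identity that
  drives the proof of \<open>partial_sums_bounded_above\<close>.\<close>

primrec running_max :: "('a \<Rightarrow> real) \<Rightarrow> nat \<Rightarrow> (nat \<Rightarrow> 'a) \<Rightarrow> real"
  where
    "running_max Z 0 \<omega> = 0"
  | "running_max Z (Suc n) \<omega> = max 0 (Z (\<omega> 1) + running_max Z n (shift \<omega>))"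

lemma shift_resample: "shift (fun_upd \<omega> 1 x) = shift \<omega>"
  by (auto simp: shift_def)

lemma running_max_nonneg: "0 \<le> running_max Z n \<omega>"
  by (cases n) auto

lemma running_max_mono: "running_max Z n \<omega> \<le> running_max Z (Suc n) \<omega>"
proof (induction n arbitrary: \<omega>)
  case (Suc n)
  show ?case using Suc[of "shift \<omega>"] by auto
qed simp

lemma partial_sum_le_running_max: "(\<Sum>i=1..n. Z (\<omega> i)) \<le> running_max Z n \<omega>"
proof (induction n arbitrary: \<omega>)
  case (Suc n)
  have "(\<Sum>i=1..Suc n. Z (\<omega> i)) = Z (\<omega> 1) + (\<Sum>i=1..n. Z (\<omega> (Suc i)))"
    by (simp add: sum.atLeast_Suc_atMost sum.shift_bounds_cl_Suc_ivl del: sum.cl_ivl_Suc)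
  also have "(\<Sum>i=1..n. Z (\<omega> (Suc i))) = (\<Sum>i=1..n. Z (shift \<omega> i))"
    by (simp add: shift_def)
  also have "Z (\<omega> 1) + \<dots> \<le> Z (\<omega> 1) + running_max Z n (shift \<omega>)"
    using Suc[of "shift \<omega>"] by simp
  finally show ?case by simp
qed simp

lemma unbounded_running_max_shift:
  "(\<forall>c. \<exists>n. c < running_max Z n (shift \<omega>)) \<longleftrightarrow> (\<forall>c. \<exists>n. c < running_max Z n \<omega>)"
proof safe
  fix c assume "\<forall>c. \<exists>n. c < running_max Z n (shift \<omega>)"
  then obtain n where "c - Z (\<omega> 1) < running_max Z n (shift \<omega>)" by blast
  then show "\<exists>n. c < running_max Z n \<omega>" by (intro exI[of _ "Suc n"]) auto
next
  fix c assume "\<forall>c. \<exists>n. c < running_max Z n \<omega>"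
  then obtain n where "max 0 (Z (\<omega> 1) + c) < running_max Z n \<omega>" by blast
  then show "\<exists>n. c < running_max Z n (shift \<omega>)" by (cases n) auto
qed

locale iid_sequence = N: prob_space N for N :: "'a measure"
begin

definition P :: "(nat \<Rightarrow> 'a) measure" where "P = (\<Pi>\<^sub>M i\<in>{1..}. N)"

sublocale P: prob_space P
  unfolding P_def by (intro prob_space_PiM N.prob_space_axioms)

sublocale PN: pair_prob_space P N ..

lemma measurable_component: "1 \<le> i \<Longrightarrow> (\<lambda>\<omega>. \<omega> i) \<in> measurable P N"
  unfolding P_def by (rule measurable_component_singleton) simp

lemma space_P: "\<omega> \<in> space P \<Longrightarrow> 1 \<le> i \<Longrightarrow> \<omega> i \<in> space N"
  by (auto simp: P_def space_PiM)

text \<open>The next facts say that replacing the \<open>k\<close>-th observation by a fresh independent draw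
  leaves the law \<open>P\<close> of the sequence unchanged. For a product of a function of the \<open>k\<close>-th
  observation and one that ignores it, this expresses independence; it also lets conditional
  expectations be computed as integrals over the new draw.\<close>

lemma measurable_resample:
  assumes "1 \<le> k"
  shows "(\<lambda>(\<omega>, x). fun_upd \<omega> k x) \<in> measurable (P \<Otimes>\<^sub>M N) P"
proof -
  have eq: "insert k {1..} = ({1..} :: nat set)" using assms by auto
  have "(\<lambda>z. (fst z)(k := snd z)) \<in> measurable (P \<Otimes>\<^sub>M N) (\<Pi>\<^sub>M i\<in>insert k {1..}. N)"
    by (rule measurable_fun_upd[where J="{1..}"]) (auto simp: P_def)
  then show ?thesis unfolding eq P_def[symmetric] by (simp add: case_prod_unfold)
qed

lemma distr_resample:
  assumes "1 \<le> k"
  shows "distr (P \<Otimes>\<^sub>M N) P (\<lambda>(\<omega>, x). fun_upd \<omega> k x) = P"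
proof -
  have eq: "insert k {1..} = ({1..} :: nat set)" using assms by auto
  interpret NP: pair_sigma_finite N P ..
  have m: "(\<lambda>(x, \<omega>). fun_upd \<omega> k x) \<in> measurable (N \<Otimes>\<^sub>M P) P"
    using measurable_compose[OF measurable_pair_swap' measurable_resample[OF assms]]
    by (simp add: case_prod_unfold)
  have "distr (P \<Otimes>\<^sub>M N) P (\<lambda>(\<omega>, x). fun_upd \<omega> k x) = distr (N \<Otimes>\<^sub>M P) P (\<lambda>(x, \<omega>). fun_upd \<omega> k x)"
    by (subst PN.distr_pair_swap, subst distr_distr[OF measurable_resample[OF assms] measurable_pair_swap'])
      (simp add: comp_def case_prod_unfold)
  also have "\<dots> = P"
    using distr_pair_PiM_eq_PiM[of "{1..}" "\<lambda>_. N" k] N.prob_space_axioms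
    unfolding eq P_def by simp
  finally show ?thesis .
qed

lemma nn_integral_resample:
  assumes "1 \<le> k" and [measurable]: "g \<in> borel_measurable P"
  shows "(\<integral>\<^sup>+\<omega>. g \<omega> \<partial>P) = (\<integral>\<^sup>+\<omega>. \<integral>\<^sup>+x. g (fun_upd \<omega> k x) \<partial>N \<partial>P)"
proof -
  have "(\<integral>\<^sup>+\<omega>. g \<omega> \<partial>P) = (\<integral>\<^sup>+z. g (case z of (\<omega>, x) \<Rightarrow> fun_upd \<omega> k x) \<partial>(P \<Otimes>\<^sub>M N))"
    by (subst distr_resample[OF assms(1), symmetric], rule nn_integral_distr)
      (use measurable_resample[OF assms(1)] assms(2) in simp_all)
  also have "\<dots> = (\<integral>\<^sup>+\<omega>. \<integral>\<^sup>+x. g (fun_upd \<omega> k x) \<partial>N \<partial>P)"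
    by (subst N.nn_integral_fst[symmetric])
      (use measurable_compose[OF measurable_resample[OF assms(1)] assms(2)] in simp_all)
  finally show ?thesis .
qed

lemma integrable_resample_pair:
  fixes g :: "(nat \<Rightarrow> 'a) \<Rightarrow> real"
  assumes "1 \<le> k" "integrable P g"
  shows "integrable (P \<Otimes>\<^sub>M N) (\<lambda>(\<omega>, x). g (fun_upd \<omega> k x))"
  using integrable_distr[OF measurable_resample[OF assms(1)], of g] assms(2)
  unfolding distr_resample[OF assms(1)] by (simp add: case_prod_unfold)

lemma
  fixes g :: "(nat \<Rightarrow> 'a) \<Rightarrow> real"
  assumes "1 \<le> k" "integrable P g"
  shows AE_integrable_resample: "AE \<omega> in P. integrable N (\<lambda>x. g (fun_upd \<omega> k x))"
    and integrable_resample: "integrable P (\<lambda>\<omega>. \<integral>x. g (fun_upd \<omega> k x) \<partial>N)"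
    and integral_resample: "(\<integral>\<omega>. \<integral>x. g (fun_upd \<omega> k x) \<partial>N \<partial>P) = (\<integral>\<omega>. g \<omega> \<partial>P)"
proof -
  note int = integrable_resample_pair[OF assms]
  show "AE \<omega> in P. integrable N (\<lambda>x. g (fun_upd \<omega> k x))"
    using PN.AE_integrable_fst'[OF int] by simp
  show "integrable P (\<lambda>\<omega>. \<integral>x. g (fun_upd \<omega> k x) \<partial>N)"
    using PN.integrable_fst'[OF int] by simp
  have "(\<integral>\<omega>. g \<omega> \<partial>P) = (\<integral>z. g (case z of (\<omega>, x) \<Rightarrow> fun_upd \<omega> k x) \<partial>(P \<Otimes>\<^sub>M N))"
    by (subst distr_resample[OF assms(1), symmetric])
      (rule integral_distr[OF measurable_resample[OF assms(1)] borel_measurable_integrable[OF assms(2)]])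
  then show "(\<integral>\<omega>. \<integral>x. g (fun_upd \<omega> k x) \<partial>N \<partial>P) = (\<integral>\<omega>. g \<omega> \<partial>P)"
    using PN.integral_fst'[OF int] by (simp add: case_prod_unfold)
qed

lemma AE_resample:
  assumes "1 \<le> k" "AE \<omega> in P. R \<omega>"
  shows "AE \<omega> in P. AE x in N. R (fun_upd \<omega> k x)"
proof -
  have "AE z in P \<Otimes>\<^sub>M N. R (case z of (\<omega>, x) \<Rightarrow> fun_upd \<omega> k x)"
    using AE_distrD[OF measurable_resample[OF assms(1)]] assms(2)
    by (metis (no_types, lifting) distr_resample[OF assms(1)])
  from PN.AE_pair[OF this] show ?thesis by simp
qed

lemma AE_component:
  assumes "1 \<le> i" "AE x in N. R x" shows "AE \<omega> in P. R (\<omega> i)"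
  unfolding P_def using assms N.prob_space_axioms by (intro AE_PiM_component) auto

lemma measurable_shift[measurable]: "shift \<in> measurable P P"
  unfolding shift_def[abs_def] P_def by measurable

lemma distr_shift: "distr P P shift = P"
  using distr_PiM_reindex[of "{1..}" "\<lambda>_. N" Suc "{1..}"] N.prob_space_axioms
  by (simp add: P_def shift_def[abs_def] Pi_iff)

lemma
  fixes g :: "(nat \<Rightarrow> 'a) \<Rightarrow> real"
  assumes "integrable P g"
  shows integrable_shift: "integrable P (\<lambda>\<omega>. g (shift \<omega>))"
    and integral_shift: "(\<integral>\<omega>. g (shift \<omega>) \<partial>P) = (\<integral>\<omega>. g \<omega> \<partial>P)"
proof -
  show "integrable P (\<lambda>\<omega>. g (shift \<omega>))"
    using integrable_distr[OF measurable_shift, of g] assms by (simp add: distr_shift)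
  show "(\<integral>\<omega>. g (shift \<omega>) \<partial>P) = (\<integral>\<omega>. g \<omega> \<partial>P)"
    using integral_distr[OF measurable_shift, of g] assms by (simp add: distr_shift)
qed

lemma integrable_component:
  fixes Z :: "'a \<Rightarrow> real"
  assumes "integrable N Z" shows "integrable P (\<lambda>\<omega>. Z (\<omega> 1))"
proof -
  have "distr P N (\<lambda>\<omega>. \<omega> 1) = N"
    unfolding P_def by (rule distr_PiM_component) (auto intro: N.prob_space_axioms)
  then show ?thesis using integrable_distr[OF measurable_component[of 1], of Z] assms by simp
qed

lemma integrable_running_max:
  assumes "integrable N Z" shows "integrable P (running_max Z n)"
proof (induction n)
  case (Suc n)
  show ?case
    using integrable_shift[OF Suc] integrable_component[OF assms] by simp
qed simp

text \<open>The half of the strong law of large numbers that needs only an integrable summand, by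
  Garsia's proof of the maximal ergodic lemma. Let \<open>E\<close> be the event that the running maxima
  \<open>R n\<close> are unbounded; it is invariant under the shift. On \<open>E\<close> the difference between
  \<open>R (n + 1)\<close> and the shifted \<open>R n\<close> equals \<open>Z (\<omega> 1)\<close> for large \<open>n\<close> and is dominated by
  \<open>\<bar>Z (\<omega> 1)\<bar>\<close>, whereas its integral over \<open>E\<close> is nonnegative since the shift preserves \<open>P\<close> and
  \<open>R\<close> increases. Hence \<open>Z (\<omega> 1)\<close> has nonnegative integral over \<open>E\<close>. But \<open>E\<close> does not depend on
  the first observation, so this integral is the probability of \<open>E\<close> times the negative mean of
  \<open>Z\<close>, and \<open>E\<close> is a null event.\<close>

theorem partial_sums_bounded_above:
  fixes Z :: "'a \<Rightarrow> real"
  assumes Z: "integrable N Z" and neg: "(\<integral>x. Z x \<partial>N) < 0"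
  shows "AE \<omega> in P. \<exists>c. \<forall>n. (\<Sum>i=1..n. Z (\<omega> i)) \<le> c"
proof -
  let ?R = "running_max Z"
  note int = integrable_running_max[OF Z]
  have [measurable]: "?R n \<in> borel_measurable P" for n using int by measurable
  have [measurable]: "Z \<in> borel_measurable N" using Z by measurable
  \<comment> \<open>Thresholds from \<open>nat\<close> make the quantifier countable, hence \<open>E\<close> measurable.\<close>
  define E where "E \<omega> \<longleftrightarrow> (\<forall>c::nat. \<exists>n. real c < ?R n \<omega>)" for \<omega>
  have E_iff: "E \<omega> \<longleftrightarrow> (\<forall>c. \<exists>n. c < ?R n \<omega>)" for \<omega>
    unfolding E_def by (meson less_trans reals_Archimedean2)
  have E_shift: "E (shift \<omega>) = E \<omega>" for \<omega>
    unfolding E_iff by (rule unbounded_running_max_shift)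
  have [measurable]: "Measurable.pred P E" unfolding E_def by measurable
  define e :: "(nat \<Rightarrow> 'a) \<Rightarrow> real" where "e \<omega> = (if E \<omega> then 1 else 0)" for \<omega>
  have [measurable]: "e \<in> borel_measurable P" unfolding e_def by measurable
  have int_e: "integrable P (\<lambda>\<omega>. e \<omega> * g \<omega>)" if "integrable P g" for g
    by (rule Bochner_Integration.integrable_bound[OF that])
      (use borel_measurable_integrable[OF that] in \<open>auto simp: e_def\<close>)
  define D where "D n \<omega> = e \<omega> * (?R (Suc n) \<omega> - ?R n (shift \<omega>))" for n \<omega>
  have D_bound: "\<bar>D n \<omega>\<bar> \<le> \<bar>Z (\<omega> 1)\<bar>" for n \<omega>
    using running_max_nonneg[of Z n "shift \<omega>"] by (auto simp: D_def e_def)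
  have D_lim: "(\<lambda>n. D n \<omega>) \<longlonglongrightarrow> e \<omega> * Z (\<omega> 1)" for \<omega>
  proof (cases "E \<omega>")
    case True
    then obtain m where m: "- Z (\<omega> 1) < ?R m (shift \<omega>)" using E_shift E_iff by blast
    have "D n \<omega> = e \<omega> * Z (\<omega> 1)" if "m \<le> n" for n
    proof -
      have "?R m (shift \<omega>) \<le> ?R n (shift \<omega>)"
        by (rule lift_Suc_mono_le[of "\<lambda>n. ?R n (shift \<omega>)", OF running_max_mono that])
      then show ?thesis using m by (simp add: D_def)
    qed
    then have "\<forall>\<^sub>F n in sequentially. D n \<omega> = e \<omega> * Z (\<omega> 1)" by (auto simp: eventually_sequentially)
    then show ?thesis by (rule tendsto_eventually)
  qed (simp add: D_def e_def)
  have "0 \<le> (\<integral>\<omega>. D n \<omega> \<partial>P)" for n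
  proof -
    have "(\<integral>\<omega>. D n \<omega> \<partial>P) = (\<integral>\<omega>. e \<omega> * ?R (Suc n) \<omega> - e (shift \<omega>) * ?R n (shift \<omega>) \<partial>P)"
      by (intro Bochner_Integration.integral_cong refl)
        (simp add: D_def e_def E_shift del: running_max.simps)
    also have "\<dots> = (\<integral>\<omega>. e \<omega> * ?R (Suc n) \<omega> \<partial>P) - (\<integral>\<omega>. e (shift \<omega>) * ?R n (shift \<omega>) \<partial>P)"
      by (intro Bochner_Integration.integral_diff int_e int integrable_shift[OF int_e[OF int]])
    also have "\<dots> = (\<integral>\<omega>. e \<omega> * ?R (Suc n) \<omega> \<partial>P) - (\<integral>\<omega>. e \<omega> * ?R n \<omega> \<partial>P)"
      using integral_shift[OF int_e[OF int]] by simp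
    finally have "(\<integral>\<omega>. D n \<omega> \<partial>P) =
        (\<integral>\<omega>. e \<omega> * ?R (Suc n) \<omega> \<partial>P) - (\<integral>\<omega>. e \<omega> * ?R n \<omega> \<partial>P)" .
    moreover have "(\<integral>\<omega>. e \<omega> * ?R n \<omega> \<partial>P) \<le> (\<integral>\<omega>. e \<omega> * ?R (Suc n) \<omega> \<partial>P)"
      using running_max_mono by (intro integral_mono int_e int mult_left_mono) (auto simp: e_def)
    ultimately show ?thesis by linarith
  qed
  moreover have "(\<lambda>n. \<integral>\<omega>. D n \<omega> \<partial>P) \<longlonglongrightarrow> (\<integral>\<omega>. e \<omega> * Z (\<omega> 1) \<partial>P)"
  proof (rule integral_dominated_convergence[where w = "\<lambda>\<omega>. \<bar>Z (\<omega> 1)\<bar>"])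
    show "D n \<in> borel_measurable P" for n
      unfolding D_def using borel_measurable_integrable[OF int[of "Suc n"]] by measurable
  qed (use D_lim D_bound integrable_component[OF Z] in auto)
  ultimately have "0 \<le> (\<integral>\<omega>. e \<omega> * Z (\<omega> 1) \<partial>P)"
    by (intro LIMSEQ_le_const) auto
  also have "\<dots> = (\<integral>\<omega>. \<integral>x. e (fun_upd \<omega> 1 x) * Z ((fun_upd \<omega> 1 x) 1) \<partial>N \<partial>P)"
    by (rule integral_resample[OF order_refl int_e[OF integrable_component[OF Z]], symmetric])
  also have "\<dots> = (\<integral>\<omega>. e \<omega> * (\<integral>x. Z x \<partial>N) \<partial>P)"
  proof -
    have "E (fun_upd \<omega> 1 x) = E \<omega>" for \<omega> x using E_shift shift_resample by metis
    then show ?thesis by (simp add: e_def)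
  qed
  also have "\<dots> = P.prob {\<omega>\<in>space P. E \<omega>} * (\<integral>x. Z x \<partial>N)"
  proof -
    have "(\<integral>\<omega>. e \<omega> \<partial>P) = (\<integral>\<omega>. indicator {\<omega>\<in>space P. E \<omega>} \<omega> \<partial>P)"
      by (intro Bochner_Integration.integral_cong) (auto simp: e_def)
    then show ?thesis by simp
  qed
  finally have "P.prob {\<omega>\<in>space P. E \<omega>} = 0"
    using neg by (simp add: zero_le_mult_iff) (metis measure_nonneg order_antisym)
  then have "AE \<omega> in P. \<not> E \<omega>"
    by (subst AE_iff_measurable[OF _ refl]) (auto simp: P.emeasure_eq_measure)
  then show ?thesis
  proof eventually_elim
    fix \<omega> assume "\<not> E \<omega>"
    then obtain c where "\<And>n. ?R n \<omega> \<le> c" unfolding E_iff by (meson not_less)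
    then show "\<exists>c. \<forall>n. (\<Sum>i=1..n. Z (\<omega> i)) \<le> c"
      using partial_sum_le_running_max[of Z \<omega>] by (meson order_trans)
  qed
qed

end

section \<open>Kullback--Leibler divergence as an expectation\<close>

lemma densitiesD:
  assumes "f \<in> densities M"
  shows "f \<in> borel_measurable M" "\<And>x. x \<in> space M \<Longrightarrow> 0 \<le> f x" "(\<integral>\<^sup>+x. ennreal (f x) \<partial>M) = 1"
  using assms by (auto simp: densities_def)

text \<open>Where the integrand of the divergence is integrable, the extended-real difference of
  positive and negative part collapses to an ordinary integral. The first assumption excludes,
  up to a null set, points with \<open>f x = 0 < f0 x\<close>: there the extended integrand
  is infinite, but the real expression \<open>f0 x * ln (f0 x / f x)\<close> takes the default value 0.\<close>

lemma kl_div_eq_integral: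
  assumes pos: "AE x in M. f0 x = 0 \<or> f x \<noteq> 0"
    and int: "integrable M (\<lambda>x. f0 x * ln (f0 x / f x))"
  shows "kl_div M f f0 = ereal (\<integral>x. f0 x * ln (f0 x / f x) \<partial>M)"
proof -
  let ?h = "\<lambda>x. f0 x * ln (f0 x / f x)"
  have "(\<integral>\<^sup>+x. e2ennreal (kl_integrand f f0 x) \<partial>M) = (\<integral>\<^sup>+x. ennreal (?h x) \<partial>M)"
    using pos by (intro nn_integral_cong_AE, eventually_elim) (auto simp: kl_integrand_def zero_ereal_def)
  moreover have "(\<integral>\<^sup>+x. e2ennreal (- kl_integrand f f0 x) \<partial>M) = (\<integral>\<^sup>+x. ennreal (- ?h x) \<partial>M)"
    using pos by (intro nn_integral_cong_AE, eventually_elim) (auto simp: kl_integrand_def zero_ereal_def)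
  moreover have "(\<integral>\<^sup>+x. ennreal (?h x) \<partial>M) \<noteq> \<infinity>" "(\<integral>\<^sup>+x. ennreal (- ?h x) \<partial>M) \<noteq> \<infinity>"
    using int by (simp_all add: real_integrable_def)
  ultimately show ?thesis
    unfolding kl_div_def real_lebesgue_integral_def[OF int]
    by (cases "\<integral>\<^sup>+x. ennreal (?h x) \<partial>M"; cases "\<integral>\<^sup>+x. ennreal (- ?h x) \<partial>M") (auto simp: enn2ereal_ennreal)
qed

lemma measurable_kl_integrand[measurable]:
  assumes [measurable]: "f \<in> borel_measurable M" "f0 \<in> borel_measurable M"
  shows "kl_integrand f f0 \<in> borel_measurable M"
  unfolding kl_integrand_def[abs_def] by measurable

text \<open>From \<open>ln t \<le> t - 1\<close> with \<open>t = f x / f0 x\<close>. Hence the negative part of the integrand of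
  the divergence always has integral at most 1.\<close>

lemma negative_part_kl_integrand_le:
  assumes "0 \<le> f x" "0 \<le> f0 x"
  shows "e2ennreal (- kl_integrand f f0 x) \<le> ennreal (f x)"
proof (cases "f0 x = 0 \<or> f x = 0")
  case True
  then show ?thesis by (auto simp: kl_integrand_def e2ennreal_neg)
next
  case False
  then have pos: "0 < f x" "0 < f0 x" using assms by auto
  have "- (f0 x * ln (f0 x / f x)) = f0 x * ln (f x / f0 x)"
    using pos by (simp add: ln_div algebra_simps)
  also have "\<dots> \<le> f0 x * (f x / f0 x - 1)"
    using pos by (intro mult_left_mono ln_le_minus_one) auto
  also have "\<dots> \<le> f x" using pos by (simp add: field_simps)
  finally show ?thesis using False by (simp add: kl_integrand_def ennreal_leI)
qed

lemma finite_kl_div: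
  assumes f: "f \<in> densities M" and f0: "f0 \<in> densities M" and less: "kl_div M f f0 < \<infinity>"
  shows "AE x in M. f0 x = 0 \<or> f x \<noteq> 0"
    and "integrable M (\<lambda>x. f0 x * ln (f0 x / f x))"
proof -
  note [measurable] = densitiesD(1)[OF f] densitiesD(1)[OF f0]
  let ?h = "\<lambda>x. f0 x * ln (f0 x / f x)"
  let ?p = "\<integral>\<^sup>+x. e2ennreal (kl_integrand f f0 x) \<partial>M"
  let ?q = "\<integral>\<^sup>+x. e2ennreal (- kl_integrand f f0 x) \<partial>M"
  have "?q \<le> (\<integral>\<^sup>+x. ennreal (f x) \<partial>M)"
    by (intro nn_integral_mono negative_part_kl_integrand_le densitiesD[OF f] densitiesD[OF f0])
  then have q: "?q \<noteq> \<infinity>" using densitiesD(3)[OF f] by (auto simp: top_unique)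
  have p: "?p \<noteq> \<infinity>"
  proof
    assume "?p = \<infinity>"
    then have "kl_div M f f0 = \<infinity>" using q by (cases ?q) (auto simp: kl_div_def)
    then show False using less by simp
  qed
  have "AE x in M. e2ennreal (kl_integrand f f0 x) \<noteq> \<infinity>"
    using p by (intro nn_integral_PInf_AE) measurable
  then show pos: "AE x in M. f0 x = 0 \<or> f x \<noteq> 0"
    by eventually_elim (auto simp: kl_integrand_def split: if_splits)
  have "(\<integral>\<^sup>+x. ennreal (?h x) \<partial>M) = ?p"
    using pos by (intro nn_integral_cong_AE, eventually_elim) (auto simp: kl_integrand_def zero_ereal_def)
  moreover have "(\<integral>\<^sup>+x. ennreal (- ?h x) \<partial>M) = ?q"
    using pos by (intro nn_integral_cong_AE, eventually_elim) (auto simp: kl_integrand_def zero_ereal_def)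
  ultimately show "integrable M ?h" using p q by (simp add: real_integrable_def)
qed

section \<open>The likelihood ratio and its integrals\<close>

locale bayesian_model =
  fixes M :: "'a measure" and f0 :: "'a \<Rightarrow> real" and Q :: "('a \<Rightarrow> real) measure"
  assumes true_density: "f0 \<in> densities M" and prior: "is_prior M Q"
begin

lemma measurable_f0[measurable]: "f0 \<in> borel_measurable M"
  and f0_nonneg: "x \<in> space M \<Longrightarrow> 0 \<le> f0 x"
  using densitiesD[OF true_density] by auto

abbreviation N :: "'a measure" where "N \<equiv> density M (\<lambda>x. ennreal (f0 x))"

sublocale iid_sequence N
proof (unfold iid_sequence_def, rule prob_spaceI)
  have "emeasure N (space N) = (\<integral>\<^sup>+x. ennreal (f0 x) * indicator (space M) x \<partial>M)"
    by (simp add: emeasure_density)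
  also have "\<dots> = (\<integral>\<^sup>+x. ennreal (f0 x) \<partial>M)" by (intro nn_integral_cong) auto
  finally show "emeasure N (space N) = 1" using densitiesD(3)[OF true_density] by simp
qed

lemma sample_measure_eq: "sample_measure M f0 = P"
  by (simp add: sample_measure_def P_def)

sublocale Q: prob_space Q
  using prior by (simp add: is_prior_def)

sublocale QP: pair_prob_space Q P ..

lemma prior_density: "f \<in> space Q \<Longrightarrow> f \<in> densities M"
  using prior by (auto simp: is_prior_def)

lemma measurable_evaluation[measurable (raw)]:
  assumes "g \<in> measurable R Q" "h \<in> measurable R M"
  shows "(\<lambda>z. g z (h z)) \<in> borel_measurable R"
proof -
  have "(\<lambda>(f, x). f x) \<in> borel_measurable (Q \<Otimes>\<^sub>M M)" using prior by (simp add: is_prior_def)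
  from measurable_compose[OF measurable_Pair[OF assms] this] show ?thesis by simp
qed

lemma observation_in_space: "\<omega> \<in> space P \<Longrightarrow> 1 \<le> i \<Longrightarrow> \<omega> i \<in> space M"
  using space_P by fastforce

lemma lik_ratio_nonneg:
  "\<omega> \<in> space P \<Longrightarrow> f \<in> space Q \<Longrightarrow> 0 \<le> lik_ratio f0 n \<omega> f"
  unfolding lik_ratio_def
  by (intro prod_nonneg divide_nonneg_nonneg f0_nonneg densitiesD(2)[OF prior_density] ballI
      observation_in_space) auto

lemma measurable_lik_ratio[measurable (raw)]:
  assumes [measurable]: "g \<in> measurable R P" "h \<in> measurable R Q"
  shows "(\<lambda>z. lik_ratio f0 n (g z) (h z)) \<in> borel_measurable R"
proof -
  have [measurable]: "(\<lambda>z. g z i) \<in> measurable R M" if "i \<in> {1..n}" for i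
    using measurable_compose[OF assms(1) measurable_component, of i] that by simp
  show ?thesis unfolding lik_ratio_def by measurable
qed

lemma lik_ratio_Suc_resample:
  "lik_ratio f0 (Suc n) (fun_upd \<omega> (Suc n) x) f = f x * lik_ratio f0 n \<omega> f / f0 x"
proof -
  have "lik_ratio f0 n (fun_upd \<omega> (Suc n) x) f = lik_ratio f0 n \<omega> f"
    unfolding lik_ratio_def by (intro prod.cong) auto
  then show ?thesis by (simp add: lik_ratio_def)
qed

section \<open>A lower bound for the marginal likelihood\<close>

text \<open>Under the law of a single observation \<open>ln (f0 / f) - e\<close> has negative mean, so its sums
  over the observations are bounded above; these sums are minus the logarithm of
  \<open>lik_ratio f0 n \<omega> f * exp (n * e)\<close>. The bound is taken of the form \<open>1 / Suc m\<close> so that the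
  event is described with countable quantifiers only.\<close>

lemma likelihood_lower_bound:
  assumes f: "f \<in> space Q" and close: "kl_div M f f0 < ereal e"
  shows "AE \<omega> in P. \<exists>m::nat. \<forall>n. 1 / real (Suc m) \<le> lik_ratio f0 n \<omega> f * exp (real n * e)"
proof -
  note dens = prior_density[OF f]
  note [measurable] = densitiesD(1)[OF dens]
  have "kl_div M f f0 < \<infinity>" using close by (auto intro: less_trans)
  note fin = finite_kl_div[OF dens true_density this]
  let ?h = "\<lambda>x. f0 x * ln (f0 x / f x)"
  let ?l = "\<lambda>x. ln (f0 x / f x)"
  have int: "integrable N ?l"
    using fin(2) by (subst integrable_density) (auto simp: f0_nonneg)
  have "(\<integral>x. ?l x \<partial>N) = (\<integral>x. ?h x \<partial>M)"
    by (subst integral_density) (auto simp: f0_nonneg)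
  then have "(\<integral>x. ?l x \<partial>N) < e"
    using close kl_div_eq_integral[OF fin] by simp
  then have neg: "(\<integral>x. ?l x - e \<partial>N) < 0"
    using int N.prob_space by simp
  have "AE x in N. 0 < f x \<and> 0 < f0 x"
  proof (subst AE_density)
    show "AE x in M. 0 < ennreal (f0 x) \<longrightarrow> 0 < f x \<and> 0 < f0 x"
      using fin(1) AE_space by eventually_elim (use densitiesD(2)[OF dens] in \<open>auto simp: less_le f0_nonneg\<close>)
  qed measurable
  then have "AE \<omega> in P. \<forall>i\<in>{1..}. 0 < f (\<omega> i) \<and> 0 < f0 (\<omega> i)"
    using AE_component[OF _ \<open>AE x in N. 0 < f x \<and> 0 < f0 x\<close>]
    by (simp add: AE_ball_countable del: AE_conj_iff)
  moreover have "AE \<omega> in P. \<exists>c. \<forall>n. (\<Sum>i=1..n. ?l (\<omega> i) - e) \<le> c"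
    using int neg by (intro partial_sums_bounded_above) auto
  ultimately show ?thesis
  proof eventually_elim
    case (elim \<omega>)
    then obtain c where c: "\<And>n. (\<Sum>i=1..n. ?l (\<omega> i) - e) \<le> c" by blast
    obtain m where m: "1 / real (Suc m) < exp (- c)" using nat_approx_posE[of "exp (- c)"] by auto
    have "1 / real (Suc m) \<le> lik_ratio f0 n \<omega> f * exp (real n * e)" for n
    proof -
      have "lik_ratio f0 n \<omega> f = (\<Prod>i=1..n. exp (- ?l (\<omega> i)))"
        unfolding lik_ratio_def
      proof (intro prod.cong refl)
        fix i assume "i \<in> {1..n}"
        then have "0 < f (\<omega> i)" "0 < f0 (\<omega> i)" using elim(1) by auto
        then show "f (\<omega> i) / f0 (\<omega> i) = exp (- ?l (\<omega> i))" by (simp add: exp_minus)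
      qed
      also have "\<dots> = exp (- (\<Sum>i=1..n. ?l (\<omega> i)))" by (simp add: exp_sum[symmetric] sum_negf)
      finally have "lik_ratio f0 n \<omega> f * exp (real n * e) = exp (- (\<Sum>i=1..n. ?l (\<omega> i) - e))"
        by (simp add: exp_add[symmetric] sum_subtractf)
      also have "exp (- c) \<le> \<dots>" using c[of n] by simp
      finally show ?thesis using m by simp
    qed
    then show ?case by blast
  qed
qed

text \<open>By Fubini the preceding bound holds, for almost every \<open>\<omega>\<close>, at almost all densities of
  the Kullback--Leibler neighbourhood \<open>K\<close>. Those for which the constant is \<open>1 / Suc m\<close> exhaust
  \<open>K\<close> up to a null set as \<open>m\<close> grows, so for some \<open>m\<close> they have positive prior probability and
  alone contribute the claimed amount to the integral. The integrability premise is there since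
  the Bochner integral of a non-integrable function is 0.\<close>

theorem marginal_likelihood_lower_bound:
  assumes KL: "KL_property M Q f0" and "0 < e"
  shows "AE \<omega> in P. \<exists>c>0. \<forall>n. integrable Q (lik_ratio f0 n \<omega>) \<longrightarrow>
    c * exp (- (real n * e)) \<le> (\<integral>f. lik_ratio f0 n \<omega> f \<partial>Q)"
proof -
  define K where "K = {f \<in> space Q. kl_div M f f0 < ereal e}"
  have K_pos: "0 < emeasure Q K" using KL \<open>0 < e\<close> by (simp add: KL_property_def K_def)
  have [measurable]: "K \<in> sets Q"
    using K_pos emeasure_notin_sets by fastforce
  have "AE f in Q. AE \<omega> in P. f \<in> K \<longrightarrow>
      (\<exists>m::nat. \<forall>n. 1 / real (Suc m) \<le> lik_ratio f0 n \<omega> f * exp (real n * e))"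
  proof (rule AE_I2)
    fix f assume "f \<in> space Q"
    show "AE \<omega> in P. f \<in> K \<longrightarrow>
      (\<exists>m::nat. \<forall>n. 1 / real (Suc m) \<le> lik_ratio f0 n \<omega> f * exp (real n * e))"
    proof (cases "f \<in> K")
      case True
      then show ?thesis using likelihood_lower_bound[of f e] by (simp add: K_def)
    qed simp
  qed
  also have "?this \<longleftrightarrow> (AE \<omega> in P. AE f in Q. f \<in> K \<longrightarrow>
      (\<exists>m::nat. \<forall>n. 1 / real (Suc m) \<le> lik_ratio f0 n \<omega> f * exp (real n * e)))"
    by (rule QP.AE_commute) measurable
  finally have ae: \<dots> .
  show ?thesis
    using ae AE_space
  proof eventually_elim
    case (elim \<omega>)
    note [measurable] = elim(2)
    define B where "B m = {f \<in> space Q. f \<in> K \<and>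
      (\<forall>n. 1 / real (Suc m) \<le> lik_ratio f0 n \<omega> f * exp (real n * e))}" for m :: nat
    have [measurable]: "B m \<in> sets Q" for m unfolding B_def by measurable
    have "\<exists>m. Q.prob (B m) \<noteq> 0"
    proof (rule ccontr)
      assume "\<not> ?thesis"
      then have "AE f in Q. f \<notin> B m" for m
        by (intro AE_not_in null_setsI) (auto simp: Q.emeasure_eq_measure)
      then have "AE f in Q. \<forall>m. f \<notin> B m" by (simp add: AE_all_countable)
      with elim(1) AE_space have "AE f in Q. f \<notin> K"
        by eventually_elim (auto simp: B_def)
      then have "emeasure Q K = 0" by (simp add: AE_iff_null_sets[symmetric] null_setsD1)
      then show False using K_pos by simp
    qed
    then obtain m where m: "0 < Q.prob (B m)" by (auto simp: zero_less_measure_iff)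
    show ?case
    proof (intro exI[of _ "Q.prob (B m) / real (Suc m)"] conjI allI impI)
      fix n assume int: "integrable Q (lik_ratio f0 n \<omega>)"
      have "Q.prob (B m) / real (Suc m) * exp (- (real n * e)) =
          (\<integral>f. indicator (B m) f * (1 / real (Suc m) * exp (- (real n * e))) \<partial>Q)"
        by simp
      also have "\<dots> \<le> (\<integral>f. lik_ratio f0 n \<omega> f \<partial>Q)"
      proof (rule integral_mono[OF _ int])
        fix f assume f: "f \<in> space Q"
        show "indicator (B m) f * (1 / real (Suc m) * exp (- (real n * e))) \<le> lik_ratio f0 n \<omega> f"
        proof (cases "f \<in> B m")
          case True
          then have "1 / real (Suc m) \<le> lik_ratio f0 n \<omega> f * exp (real n * e)" by (auto simp: B_def)
          then have "1 / real (Suc m) / exp (real n * e) \<le> lik_ratio f0 n \<omega> f"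
            by (subst pos_divide_le_eq) simp_all
          then show ?thesis using True by (simp add: exp_minus divide_inverse)
        qed (use lik_ratio_nonneg[OF elim(2) f] in simp)
      qed (simp add: Q.emeasure_eq_measure)
      finally show "Q.prob (B m) / real (Suc m) * exp (- (real n * e)) \<le> (\<integral>f. lik_ratio f0 n \<omega> f \<partial>Q)" .
    qed (use m in simp)
  qed
qed

end

section \<open>A strong law for functionals of the past\<close>

text \<open>The mean is the best constant predictor in mean square. If \<open>Y\<close> is not square
  integrable, both sides are infinite.\<close>

lemma (in prob_space) ext_variance_le:
  assumes [measurable]: "Y \<in> borel_measurable M"
  shows "ext_variance M Y \<le> (\<integral>\<^sup>+x. ennreal ((Y x - c)\<^sup>2) \<partial>M)"
proof (cases "(\<integral>\<^sup>+x. ennreal ((Y x - c)\<^sup>2) \<partial>M) = \<infinity>")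
  case False
  define Z where "Z x = Y x - c" for x
  have [measurable]: "Z \<in> borel_measurable M" by (simp add: Z_def[abs_def])
  have sq: "integrable M (\<lambda>x. (Z x)\<^sup>2)"
    using False by (intro integrableI_nonneg) (auto simp: Z_def less_top)
  then have int: "integrable M Z" by (rule square_integrable_imp_integrable[rotated]) simp
  have "expectation Y = expectation (\<lambda>x. Z x + c)" by (simp add: Z_def)
  also have "\<dots> = expectation Z + c" using int by (simp add: prob_space)
  finally have Y_eq: "Y x - expectation Y = Z x - expectation Z" for x
    by (simp add: Z_def[of x])
  have "ext_variance M Y = (\<integral>\<^sup>+x. ennreal ((Z x - expectation Z)\<^sup>2) \<partial>M)"
    by (simp add: ext_variance_def Y_eq)
  also have "\<dots> = ennreal (variance Z)"
  proof (rule nn_integral_eq_integral)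
    show "integrable M (\<lambda>x. (Z x - expectation Z)\<^sup>2)"
      using int sq by (simp add: power2_diff)
  qed simp
  also have "\<dots> \<le> ennreal (\<integral>x. (Z x)\<^sup>2 \<partial>M)"
    using int sq by (intro ennreal_leI) (simp add: variance_eq)
  also have "\<dots> = (\<integral>\<^sup>+x. ennreal ((Y x - c)\<^sup>2) \<partial>M)"
    using sq by (subst nn_integral_eq_integral[symmetric]) (auto simp: Z_def)
  finally show ?thesis .
qed simp

lemma (in prob_space) integrable_of_ext_variance_finite:
  assumes [measurable]: "Y \<in> borel_measurable M" and fin: "ext_variance M Y < \<infinity>"
  shows "integrable M Y"
proof -
  have "integrable M (\<lambda>x. (Y x - expectation Y)\<^sup>2)"
    using fin by (intro integrableI_nonneg) (auto simp: ext_variance_def)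
  then have "integrable M (\<lambda>x. Y x - expectation Y)"
    by (rule square_integrable_imp_integrable[rotated]) simp
  then have "integrable M (\<lambda>x. (Y x - expectation Y) + expectation Y)"
    by (intro Bochner_Integration.integrable_add) auto
  then show ?thesis by simp
qed

lemma ext_variance_finite_of_weighted_sum:
  assumes "(\<Sum>n. ennreal (1 / (real (Suc n))\<^sup>2) * ext_variance M (Y n)) < \<infinity>"
  shows "ext_variance M (Y n) < \<infinity>"
proof -
  have "ennreal (1 / (real (Suc n))\<^sup>2) * ext_variance M (Y n) < \<infinity>"
    using sum_le_suminf[of "\<lambda>n. ennreal (1 / (real (Suc n))\<^sup>2) * ext_variance M (Y n)" "{n}"] assms
    by (simp add: le_less_trans)
  then show ?thesis by (auto simp: ennreal_mult_less_top)
qed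

definition agree :: "nat \<Rightarrow> (nat \<Rightarrow> 'a) \<Rightarrow> (nat \<Rightarrow> 'a) \<Rightarrow> bool"
  where "agree n \<omega> \<omega>' \<longleftrightarrow> (\<forall>i\<in>{1..n}. \<omega> i = \<omega>' i)"

context iid_sequence begin

text \<open>The \<open>\<sigma>\<close>-algebra of events decided by the first \<open>n\<close> observations. Describing it by
  invariance instead of as a preimage \<open>\<sigma>\<close>-algebra turns measurability of a function with respect
  to the past into the statement that it depends on these observations only.\<close>

definition past :: "nat \<Rightarrow> (nat \<Rightarrow> 'a) measure"
  where "past n = sigma (space P)
    {B \<in> sets P. \<forall>\<omega>\<in>B. \<forall>\<omega>'\<in>space P. agree n \<omega> \<omega>' \<longrightarrow> \<omega>' \<in> B}"

lemma sets_past: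
  "sets (past n) = {B \<in> sets P. \<forall>\<omega>\<in>B. \<forall>\<omega>'\<in>space P. agree n \<omega> \<omega>' \<longrightarrow> \<omega>' \<in> B}" (is "_ = ?S")
proof -
  have sym: "agree n \<omega> \<omega>' \<Longrightarrow> agree n \<omega>' \<omega>" for \<omega> \<omega>' :: "nat \<Rightarrow> 'a"
    by (simp add: agree_def)
  have "sigma_algebra (space P) ?S"
    unfolding sigma_algebra_iff2 using sets.sets_into_space sym by blast
  then show ?thesis
    unfolding past_def by (simp add: sigma_algebra.sets_measure_of_eq)
qed

lemma space_past[simp]: "space (past n) = space P"
  unfolding past_def by (rule space_measure_of) (use sets.sets_into_space in auto)

lemma subalgebra_past: "subalgebra P (past n)"
  by (auto simp: subalgebra_def sets_past)

lemma past_mono: "m \<le> n \<Longrightarrow> sets (past m) \<subseteq> sets (past n)"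
  by (force simp: sets_past agree_def)

lemma measurable_past:
  assumes g: "g \<in> borel_measurable P"
    and det: "\<And>\<omega> \<omega>'. \<omega> \<in> space P \<Longrightarrow> \<omega>' \<in> space P \<Longrightarrow> agree n \<omega> \<omega>' \<Longrightarrow> g \<omega> = g \<omega>'"
  shows "g \<in> borel_measurable (past n)"
proof (rule measurableI)
  fix B :: "'b set" assume "B \<in> sets borel"
  then have "g -` B \<inter> space P \<in> sets P" using g by (rule measurable_sets[rotated])
  then show "g -` B \<inter> space (past n) \<in> sets (past n)"
    using det by (auto simp: sets_past)
qed simp

lemma resample_space: "\<omega> \<in> space P \<Longrightarrow> x \<in> space N \<Longrightarrow> 1 \<le> k \<Longrightarrow> fun_upd \<omega> k x \<in> space P"
  by (auto simp: P_def space_PiM PiE_iff extensional_def)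

lemma resample_past:
  assumes "B \<in> sets (past n)" "\<omega> \<in> space P" "x \<in> space N"
  shows "fun_upd \<omega> (Suc n) x \<in> B \<longleftrightarrow> \<omega> \<in> B"
proof -
  have "agree n \<omega> (fun_upd \<omega> (Suc n) x)" "agree n (fun_upd \<omega> (Suc n) x) \<omega>"
    by (auto simp: agree_def)
  then show ?thesis
    using assms resample_space[OF assms(2,3), of "Suc n"] unfolding sets_past by auto
qed

text \<open>A version of the conditional expectation of \<open>Y\<close> given the first \<open>n\<close> observations, for
  \<open>Y\<close> a function of the first \<open>n + 1\<close> observations: the last one is integrated out.\<close>

definition one_step_mean :: "((nat \<Rightarrow> 'a) \<Rightarrow> real) \<Rightarrow> nat \<Rightarrow> (nat \<Rightarrow> 'a) \<Rightarrow> real"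
  where "one_step_mean Y n \<omega> = (\<integral>x. Y (fun_upd \<omega> (Suc n) x) \<partial>N)"

lemma measurable_one_step_mean[measurable]:
  assumes "Y \<in> borel_measurable P"
  shows "one_step_mean Y n \<in> borel_measurable P"
proof -
  have "(\<lambda>(\<omega>, x). Y (fun_upd \<omega> (Suc n) x)) \<in> borel_measurable (P \<Otimes>\<^sub>M N)"
    using measurable_compose[OF measurable_resample[of "Suc n"] assms] by (simp add: case_prod_unfold)
  then show ?thesis
    unfolding one_step_mean_def[abs_def] by (rule N.borel_measurable_lebesgue_integral)
qed

lemma one_step_mean_resample:
  "one_step_mean Y n (fun_upd \<omega> (Suc n) x) = one_step_mean Y n \<omega>"
  by (simp add: one_step_mean_def)

text \<open>The differences between \<open>Y n\<close> and its one-step mean are martingale differences: by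
  resampling the observation \<open>n + 1\<close>, their integral over any event of the past vanishes. Given
  the past, the one-step mean is the best constant predictor of \<open>Y n\<close>, so the second moments of
  the differences are bounded by the variances of the \<open>Y n\<close>, and \<open>strong_law\<close> applies.\<close>

theorem strong_law_one_step_mean:
  fixes Y :: "nat \<Rightarrow> (nat \<Rightarrow> 'a) \<Rightarrow> real"
  assumes meas[measurable]: "\<And>n. Y n \<in> borel_measurable P"
    and det: "\<And>n \<omega> \<omega>'. \<lbrakk>\<omega> \<in> space P; \<omega>' \<in> space P; agree (Suc n) \<omega> \<omega>'\<rbrakk> \<Longrightarrow> Y n \<omega> = Y n \<omega>'"
    and var: "(\<Sum>n. ennreal (1 / (real (Suc n))\<^sup>2) * ext_variance P (Y n)) < \<infinity>"
  shows "AE \<omega> in P. (\<lambda>n. (\<Sum>i<n. Y i \<omega> - one_step_mean (Y i) i \<omega>) / real n) \<longlonglongrightarrow> 0"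
proof -
  let ?C = "\<lambda>n. one_step_mean (Y n) n"
  note var_fin = ext_variance_finite_of_weighted_sum[OF var]
  note int = P.integrable_of_ext_variance_finite[OF meas var_fin]
  define d where "d n \<omega> = Y n \<omega> - ?C n \<omega>" for n \<omega>
  have [measurable]: "d n \<in> borel_measurable P" for n unfolding d_def by measurable
  have C_int: "integrable P (?C n)" for n
    unfolding one_step_mean_def by (rule integrable_resample[OF _ int]) simp
  have d_int: "integrable P (d n)" for n unfolding d_def using int C_int by simp
  have C_past: "?C n \<in> borel_measurable (past n)" for n
  proof (rule measurable_past)
    fix \<omega> \<omega>' assume "\<omega> \<in> space P" "\<omega>' \<in> space P" "agree n \<omega> \<omega>'"
    then show "?C n \<omega> = ?C n \<omega>'"
      unfolding one_step_mean_def
      by (intro Bochner_Integration.integral_cong refl det resample_space) (auto simp: agree_def)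
  qed simp
  have d_sq: "(\<integral>\<^sup>+\<omega>. ennreal ((d n \<omega>)\<^sup>2) \<partial>P) \<le> ext_variance P (Y n)" for n
  proof -
    let ?c = "P.expectation (Y n)"
    have "(\<integral>\<^sup>+\<omega>. ennreal ((d n \<omega>)\<^sup>2) \<partial>P) =
        (\<integral>\<^sup>+\<omega>. \<integral>\<^sup>+x. ennreal ((d n (fun_upd \<omega> (Suc n) x))\<^sup>2) \<partial>N \<partial>P)"
      by (rule nn_integral_resample) auto
    also have "\<dots> = (\<integral>\<^sup>+\<omega>. ext_variance N (\<lambda>x. Y n (fun_upd \<omega> (Suc n) x)) \<partial>P)"
      by (simp add: ext_variance_def d_def one_step_mean_resample) (simp add: one_step_mean_def)
    also have "\<dots> \<le> (\<integral>\<^sup>+\<omega>. \<integral>\<^sup>+x. ennreal ((Y n (fun_upd \<omega> (Suc n) x) - ?c)\<^sup>2) \<partial>N \<partial>P)"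
    proof (intro nn_integral_mono N.ext_variance_le)
      fix \<omega> assume "\<omega> \<in> space P"
      then have "(\<lambda>x. fun_upd \<omega> (Suc n) x) \<in> measurable N P"
        using measurable_compose[OF measurable_Pair1' measurable_resample[of "Suc n"]] by simp
      from measurable_compose[OF this meas]
      show "(\<lambda>x. Y n (fun_upd \<omega> (Suc n) x)) \<in> borel_measurable N" .
    qed
    also have "\<dots> = ext_variance P (Y n)"
      unfolding ext_variance_def by (rule nn_integral_resample[symmetric]) auto
    finally show ?thesis .
  qed
  let ?w = "\<lambda>n. 1 / (real (Suc n))\<^sup>2"
  have d_sq_int: "integrable P (\<lambda>\<omega>. (d n \<omega>)\<^sup>2)" for n
    using le_less_trans[OF d_sq var_fin] by (intro integrableI_nonneg) auto
  interpret square_martingale_difference P past d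
  proof
    fix n
    show "d n \<in> borel_measurable (past (Suc n))"
      unfolding d_def
    proof (rule borel_measurable_diff)
      show "Y n \<in> borel_measurable (past (Suc n))" using det by (intro measurable_past) auto
      show "?C n \<in> borel_measurable (past (Suc n))"
        by (rule measurable_from_subalg[OF _ C_past])
          (simp add: subalgebra_def past_mono)
    qed
    interpret finite_measure_subalgebra P "past n" by standard (rule subalgebra_past)
    show "AE \<omega> in P. real_cond_exp P (past n) (d n) \<omega> = 0"
    proof (rule real_cond_exp_charact)
      fix B assume B: "B \<in> sets (past n)"
      then have [measurable]: "B \<in> sets P" by (simp add: sets_past)
      let ?g = "\<lambda>\<omega>. indicator B \<omega> * d n \<omega>"
      have g: "integrable P ?g" using integrable_real_mult_indicator[OF _ d_int, of B n] by (simp add: mult.commute)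
      have "(\<integral>\<omega>. ?g \<omega> \<partial>P) = (\<integral>\<omega>. \<integral>x. ?g (fun_upd \<omega> (Suc n) x) \<partial>N \<partial>P)"
        by (rule integral_resample[OF _ g, symmetric]) simp
      also have "\<dots> = (\<integral>\<omega>. 0 \<partial>P)"
      proof (rule integral_cong_AE)
        show "AE \<omega> in P. (\<integral>x. ?g (fun_upd \<omega> (Suc n) x) \<partial>N) = 0"
          using AE_integrable_resample[OF _ int, of "Suc n" n, simplified] AE_space
        proof eventually_elim
          case (elim \<omega>)
          have "(\<integral>x. ?g (fun_upd \<omega> (Suc n) x) \<partial>N) =
              (\<integral>x. indicator B \<omega> * (Y n (fun_upd \<omega> (Suc n) x) - ?C n \<omega>) \<partial>N)"
            using resample_past[OF B elim(2)]
            by (intro Bochner_Integration.integral_cong refl)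
              (auto simp: d_def one_step_mean_resample indicator_def)
          also have "\<dots> = indicator B \<omega> * ((\<integral>x. Y n (fun_upd \<omega> (Suc n) x) \<partial>N) - ?C n \<omega>)"
            using elim(1) by (simp add: N.prob_space)
          finally show ?case by (simp add: one_step_mean_def)
        qed
      qed (use borel_measurable_integrable[OF integrable_resample[OF _ g, of "Suc n"]] in auto)
      finally show "(\<integral>\<omega>\<in>B. d n \<omega> \<partial>P) = (\<integral>\<omega>\<in>B. 0 \<partial>P)"
        by (simp add: set_lebesgue_integral_def)
    qed (use d_int in auto)
  qed (use subalgebra_past past_mono d_sq_int in auto)
  have "summable (\<lambda>n. (\<integral>\<omega>. (d n \<omega>)\<^sup>2 \<partial>P) / (real (Suc n))\<^sup>2)"
  proof (rule summable_suminf_not_top)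
    have "(\<Sum>n. ennreal ((\<integral>\<omega>. (d n \<omega>)\<^sup>2 \<partial>P) / (real (Suc n))\<^sup>2)) \<le>
        (\<Sum>n. ennreal (?w n) * ext_variance P (Y n))"
    proof (intro suminf_le summableI)
      fix n
      have "ennreal ((\<integral>\<omega>. (d n \<omega>)\<^sup>2 \<partial>P) / (real (Suc n))\<^sup>2) =
          ennreal (?w n) * ennreal (\<integral>\<omega>. (d n \<omega>)\<^sup>2 \<partial>P)"
        by (simp flip: ennreal_mult)
      also have "\<dots> \<le> ennreal (?w n) * ext_variance P (Y n)"
        using d_sq[of n] d_sq_int[of n]
        by (intro mult_left_mono) (simp_all add: nn_integral_eq_integral)
      finally show "ennreal ((\<integral>\<omega>. (d n \<omega>)\<^sup>2 \<partial>P) / (real (Suc n))\<^sup>2) \<le>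
          ennreal (?w n) * ext_variance P (Y n)" .
    qed
    then show "(\<Sum>n. ennreal ((\<integral>\<omega>. (d n \<omega>)\<^sup>2 \<partial>P) / (real (Suc n))\<^sup>2)) \<noteq> \<top>"
      using var by (auto simp: top_unique)
  qed simp
  from strong_law[OF this] show ?thesis by (simp add: d_def)
qed

end

section \<open>Exponential decay of the restricted marginal likelihood\<close>

text \<open>The sum of the logarithmic increments telescopes to \<open>ln (L n / L 0)\<close>, and by assumption it
  is minus the sum of the \<open>D i\<close> up to an error \<open>o(n)\<close>. Since the \<open>D i\<close> eventually exceed some
  \<open>\<delta> > 0\<close>, the logarithm of \<open>L n\<close> decreases at least linearly; half of the rate \<open>\<delta>\<close> absorbs
  the error term.\<close>

lemma exponential_decay:
  fixes L D :: "nat \<Rightarrow> real"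
  assumes pos: "\<And>n. 0 < L n"
    and law: "(\<lambda>n. (\<Sum>i<n. ln (L (Suc i) / L i) + D i) / real n) \<longlonglongrightarrow> 0"
    and sep: "0 < liminf (\<lambda>n. ereal (D n))"
  shows "\<exists>\<delta>>0. \<exists>K. \<forall>\<^sub>F n in sequentially. L n \<le> exp (K - \<delta> * real n)"
proof -
  obtain \<delta> :: real where \<delta>: "0 < ereal \<delta>" "ereal \<delta> < liminf (\<lambda>n. ereal (D n))"
    using ereal_dense2[OF sep] by blast
  then have "0 < \<delta>" by simp
  have "\<forall>\<^sub>F n in sequentially. ereal \<delta> < ereal (D n)" using \<delta>(2) by (rule less_LiminfD)
  then obtain n0 where n0: "\<And>n. n0 \<le> n \<Longrightarrow> \<delta> < D n" by (auto simp: eventually_sequentially)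
  define K where "K = ln (L 0) - (\<Sum>i<n0. D i) + \<delta> * real n0"
  have D_sum: "(\<Sum>i<n0. D i) + \<delta> * (real n - real n0) \<le> (\<Sum>i<n. D i)" if "n0 \<le> n" for n
    using that
  proof (induction rule: dec_induct)
    case (step n)
    then show ?case using n0[of n] by (simp add: algebra_simps)
  qed simp
  have L_sum: "(\<Sum>i<n. ln (L (Suc i) / L i)) = ln (L n) - ln (L 0)" for n
  proof -
    have "ln (L (Suc i) / L i) = ln (L (Suc i)) - ln (L i)" for i
      using pos[of i] pos[of "Suc i"] by (simp add: ln_div)
    then show ?thesis using sum_lessThan_telescope[of "\<lambda>i. ln (L i)" n] by simp
  qed
  have "\<forall>\<^sub>F n in sequentially. (\<Sum>i<n. ln (L (Suc i) / L i) + D i) / real n < \<delta> / 2"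
    using \<open>0 < \<delta>\<close> by (intro order_tendstoD(2)[OF law]) simp
  then have "\<forall>\<^sub>F n in sequentially. L n \<le> exp (K - \<delta> / 2 * real n)"
    using eventually_gt_at_top[of 0] eventually_ge_at_top[of n0]
  proof eventually_elim
    case (elim n)
    then have "(\<Sum>i<n. ln (L (Suc i) / L i)) + (\<Sum>i<n. D i) < \<delta> / 2 * real n"
      by (simp add: sum.distrib field_simps)
    then have "ln (L n) \<le> K - \<delta> / 2 * real n"
      using D_sum[OF elim(3)] unfolding L_sum K_def by (simp add: algebra_simps)
    then show ?case using pos[of n] by (metis exp_le_cancel_iff exp_ln)
  qed
  then show ?thesis using \<open>0 < \<delta>\<close> by (intro exI[of _ "\<delta> / 2"]) auto
qed

context bayesian_model begin

lemma int_lik_nonneg: "\<omega> \<in> space P \<Longrightarrow> 0 \<le> int_lik Q f0 A n \<omega>"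
  unfolding int_lik_def set_lebesgue_integral_def
  by (intro integral_nonneg_AE AE_I2) (auto simp: lik_ratio_nonneg)

lemma measurable_int_lik[measurable]:
  assumes [measurable]: "A \<in> sets Q"
  shows "int_lik Q f0 A n \<in> borel_measurable P"
  unfolding int_lik_def[abs_def] set_lebesgue_integral_def by measurable

lemma int_lik_agree:
  assumes "agree n \<omega> \<omega>'" shows "int_lik Q f0 A n \<omega> = int_lik Q f0 A n \<omega>'"
proof -
  have "lik_ratio f0 n \<omega> = lik_ratio f0 n \<omega>'"
    using assms by (intro ext) (auto simp: lik_ratio_def agree_def intro!: prod.cong)
  then show ?thesis by (simp add: int_lik_def)
qed

lemma measurable_predictive:
  assumes [measurable]: "A \<in> sets Q" "\<omega> \<in> space P"
  shows "predictive Q f0 A n \<omega> \<in> borel_measurable M"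
  unfolding predictive_def[abs_def] set_lebesgue_integral_def by measurable

text \<open>The observation \<open>x\<close> multiplies the likelihood ratio of \<open>f\<close> by \<open>f x / f0 x\<close>, and
  \<open>1 / f0 x\<close> comes out of the integral over \<open>f\<close>. If the remaining integral does not exist, or if
  \<open>f0 x = 0\<close>, both sides have the value 0.\<close>

lemma int_lik_ratio_resample:
  assumes "int_lik Q f0 A n \<omega> \<noteq> 0"
  shows "int_lik Q f0 A (Suc n) (fun_upd \<omega> (Suc n) x) / int_lik Q f0 A n (fun_upd \<omega> (Suc n) x) =
    predictive Q f0 A n \<omega> x / f0 x"
proof -
  have "int_lik Q f0 A n (fun_upd \<omega> (Suc n) x) = int_lik Q f0 A n \<omega>"
    by (rule int_lik_agree) (simp add: agree_def)
  moreover have "int_lik Q f0 A (Suc n) (fun_upd \<omega> (Suc n) x) =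
      (LINT f:A|Q. f x * lik_ratio f0 n \<omega> f) / f0 x"
    unfolding int_lik_def lik_ratio_Suc_resample by simp
  ultimately show ?thesis by (simp add: predictive_def)
qed

abbreviation log_increment :: "('a \<Rightarrow> real) set \<Rightarrow> nat \<Rightarrow> (nat \<Rightarrow> 'a) \<Rightarrow> real"
  where "log_increment A n \<omega> \<equiv> ln (int_lik Q f0 A (Suc n) \<omega> / int_lik Q f0 A n \<omega>)"

text \<open>Almost surely the next increment is the logarithm of the predictive density over the true
  density at a new observation drawn from the true density. Its mean over this draw is by
  definition minus the divergence of the predictive density. Integrability of the increment and
  positivity of \<open>int_lik\<close> at time \<open>n + 1\<close> pass, for almost every past, to the section over the new
  observation, so that the divergence is finite.\<close>

lemma kl_div_predictive:
  assumes A: "A \<in> sets Q"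
    and pos: "\<And>n. AE \<omega> in P. 0 < int_lik Q f0 A n \<omega>"
    and int: "integrable P (log_increment A n)"
  shows "AE \<omega> in P. kl_div M (predictive Q f0 A n \<omega>) f0 =
    ereal (- one_step_mean (log_increment A n) n \<omega>)"
  using pos[of n] AE_resample[OF _ pos[of "Suc n"], of "Suc n", simplified]
    AE_integrable_resample[OF _ int, of "Suc n", simplified] AE_space
proof eventually_elim
  case (elim \<omega>)
  let ?p = "predictive Q f0 A n \<omega>"
  note [measurable] = measurable_predictive[OF A elim(4)]
  have ratio: "int_lik Q f0 A (Suc n) (fun_upd \<omega> (Suc n) x) /
      int_lik Q f0 A n (fun_upd \<omega> (Suc n) x) = ?p x / f0 x" for x
    using elim(1) by (intro int_lik_ratio_resample) simp
  have same: "int_lik Q f0 A n (fun_upd \<omega> (Suc n) x) = int_lik Q f0 A n \<omega>" for x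
    by (rule int_lik_agree) (simp add: agree_def)
  have pos_N: "AE x in N. 0 < ?p x / f0 x"
    using elim(2)
  proof eventually_elim
    case (elim x)
    then show ?case using \<open>0 < int_lik Q f0 A n \<omega>\<close> ratio[of x] same[of x] by (metis divide_pos_pos)
  qed
  have p_pos: "AE x in M. f0 x = 0 \<or> ?p x \<noteq> 0"
  proof -
    have "AE x in M. 0 < ennreal (f0 x) \<longrightarrow> 0 < ?p x / f0 x"
      using pos_N by (subst (asm) AE_density) auto
    then show ?thesis
      using AE_space by eventually_elim (auto simp: less_le f0_nonneg)
  qed
  have swap: "ln (f0 x / ?p x) = - ln (?p x / f0 x)" for x
    by (simp add: ln_div)
  have "integrable N (\<lambda>x. ln (?p x / f0 x))" using elim(3) unfolding ratio .
  then have "integrable N (\<lambda>x. ln (f0 x / ?p x))"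
    unfolding swap by simp
  then have int_M: "integrable M (\<lambda>x. f0 x * ln (f0 x / ?p x))"
    by (subst (asm) integrable_density) (auto simp: f0_nonneg)
  have "(\<integral>x. f0 x * ln (f0 x / ?p x) \<partial>M) = (\<integral>x. ln (f0 x / ?p x) \<partial>N)"
    by (subst integral_density) (auto simp: f0_nonneg)
  also have "\<dots> = - one_step_mean (log_increment A n) n \<omega>"
    unfolding one_step_mean_def ratio swap by simp
  finally show ?case using kl_div_eq_integral[OF p_pos int_M] by simp
qed

text \<open>The numerator of the posterior probability decays at some exponential rate \<open>\<delta>\<close>, which may
  depend on \<open>\<omega>\<close>, and the denominator decays at a rate below \<open>\<delta> / 2\<close>. To choose the latter
  rate after \<open>\<omega>\<close>, the lower bound on the denominator is taken for the countably many rates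
  \<open>1 / Suc m\<close> simultaneously.\<close>

theorem posterior_tendsto_zero:
  assumes KL: "KL_property M Q f0" and A: "A \<in> sets Q"
    and pos: "\<And>n. AE \<omega> in P. 0 < int_lik Q f0 A n \<omega>"
    and var: "(\<Sum>n. ennreal (1 / (real (Suc n))\<^sup>2) * ext_variance P (log_increment A n)) < \<infinity>"
    and sep: "AE \<omega> in P. 0 < liminf (\<lambda>n. kl_div M (predictive Q f0 A n \<omega>) f0)"
  shows "AE \<omega> in P. (\<lambda>n. posterior Q f0 n \<omega> A) \<longlonglongrightarrow> 0"
proof -
  let ?L = "int_lik Q f0 A" and ?Y = "log_increment A"
  have meas[measurable]: "?Y n \<in> borel_measurable P" for n using A by measurable
  note int = P.integrable_of_ext_variance_finite[OF meas ext_variance_finite_of_weighted_sum[OF var]]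
  have "AE \<omega> in P. \<forall>n. 0 < ?L n \<omega>" using pos by (simp add: AE_all_countable)
  moreover have "AE \<omega> in P. (\<lambda>n. (\<Sum>i<n. ?Y i \<omega> - one_step_mean (?Y i) i \<omega>) / real n) \<longlonglongrightarrow> 0"
  proof (rule strong_law_one_step_mean[OF meas _ var])
    fix n and \<omega> \<omega>' :: "nat \<Rightarrow> 'a" assume "agree (Suc n) \<omega> \<omega>'"
    moreover from this have "agree n \<omega> \<omega>'" by (simp add: agree_def)
    ultimately show "?Y n \<omega> = ?Y n \<omega>'" by (simp add: int_lik_agree)
  qed
  moreover have "AE \<omega> in P. \<forall>n. kl_div M (predictive Q f0 A n \<omega>) f0 = ereal (- one_step_mean (?Y n) n \<omega>)"
    using kl_div_predictive[OF A pos int] by (simp add: AE_all_countable)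
  moreover have "AE \<omega> in P. \<forall>m. \<exists>c>0. \<forall>n. integrable Q (lik_ratio f0 n \<omega>) \<longrightarrow>
      c * exp (- (real n * (1 / real (Suc m)))) \<le> (\<integral>f. lik_ratio f0 n \<omega> f \<partial>Q)"
    unfolding AE_all_countable by (intro allI marginal_likelihood_lower_bound[OF KL]) simp
  ultimately show ?thesis
    using sep AE_space
  proof eventually_elim
    case (elim \<omega>)
    have "\<exists>\<delta>>0. \<exists>K. \<forall>\<^sub>F n in sequentially. ?L n \<omega> \<le> exp (K - \<delta> * real n)"
      using elim(1,2,3,5) by (intro exponential_decay[where D = "\<lambda>n. - one_step_mean (?Y n) n \<omega>"]) simp_all
    then obtain \<delta> K where "0 < \<delta>" and decay: "\<forall>\<^sub>F n in sequentially. ?L n \<omega> \<le> exp (K - \<delta> * real n)"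
      by blast
    obtain m where m: "1 / real (Suc m) < \<delta> / 2"
      using nat_approx_posE[of "\<delta> / 2"] \<open>0 < \<delta>\<close> by auto
    obtain c where "0 < c" and c: "\<And>n. integrable Q (lik_ratio f0 n \<omega>) \<Longrightarrow>
        c * exp (- (real n * (1 / real (Suc m)))) \<le> (\<integral>f. lik_ratio f0 n \<omega> f \<partial>Q)"
      using elim(4) by blast
    have bound: "\<forall>\<^sub>F n in sequentially. posterior Q f0 n \<omega> A \<le> exp K / c * exp (- (\<delta> / 2 * real n))"
      using decay
    proof eventually_elim
      case (elim n)
      show ?case
      proof (cases "integrable Q (lik_ratio f0 n \<omega>)")
        case True
        let ?I = "\<integral>f. lik_ratio f0 n \<omega> f \<partial>Q"
        have "c * exp (- (\<delta> / 2 * real n)) \<le> c * exp (- (real n * (1 / real (Suc m))))"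
        proof -
          have "1 / real (Suc m) * real n \<le> \<delta> / 2 * real n"
            using m by (intro mult_right_mono) auto
          then show ?thesis using \<open>0 < c\<close> by (simp add: mult.commute)
        qed
        also have "\<dots> \<le> ?I" using c[OF True] .
        finally have I: "c * exp (- (\<delta> / 2 * real n)) \<le> ?I" .
        have "posterior Q f0 n \<omega> A = ?L n \<omega> / ?I" by (simp add: posterior_def int_lik_def)
        also have "\<dots> \<le> exp (K - \<delta> * real n) / (c * exp (- (\<delta> / 2 * real n)))"
          using I elim \<open>0 < c\<close> int_lik_nonneg \<open>\<omega> \<in> space P\<close> by (intro frac_le) auto
        also have "\<dots> = exp K / c * exp (- (\<delta> / 2 * real n))"
        proof -
          have "exp (K - \<delta> * real n) =
              exp K * exp (- (\<delta> / 2 * real n)) * exp (- (\<delta> / 2 * real n))"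
            by (simp flip: exp_add)
          then show ?thesis by simp
        qed
        finally show ?thesis .
      next
        \<comment> \<open>The denominator takes the default value 0, and so does the quotient.\<close>
        case False
        then show ?thesis using \<open>0 < c\<close> by (simp add: posterior_def not_integrable_integral_eq)
      qed
    qed
    have nonneg: "0 \<le> posterior Q f0 n \<omega> A" for n
      unfolding posterior_def set_lebesgue_integral_def
      using lik_ratio_nonneg[OF \<open>\<omega> \<in> space P\<close>]
      by (intro divide_nonneg_nonneg integral_nonneg_AE AE_I2) auto
    have "(\<lambda>n. exp (- (\<delta> / 2 * real n))) \<longlonglongrightarrow> 0"
    proof -
      have "filterlim (\<lambda>n. \<delta> / 2 * real n) at_top sequentially"
        using \<open>0 < \<delta>\<close> by (intro filterlim_tendsto_pos_mult_at_top[OF tendsto_const] filterlim_real_sequentially) simp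
      then show ?thesis
        by (intro filterlim_compose[OF exp_at_bot] filterlim_compose[OF filterlim_uminus_at_bot_at_top])
    qed
    then have "(\<lambda>n. exp K / c * exp (- (\<delta> / 2 * real n))) \<longlonglongrightarrow> 0"
      by (rule tendsto_mult_right_zero)
    from tendsto_sandwich[OF _ bound tendsto_const this] nonneg show ?case by simp
  qed
qed

end

section \<open>Posterior consistency\<close>

theorem theorem2:
  fixes X :: "'a::euclidean_space set"
    and f0 :: "'a \<Rightarrow> real"
    and Q :: "('a \<Rightarrow> real) measure"
    and A :: "('a \<Rightarrow> real) set"
  assumes "X \<in> sets borel"
    and "f0 \<in> densities (lborel_on X)"
    and "is_prior (lborel_on X) Q"
    and "KL_property (lborel_on X) Q f0"
    and "A \<in> sets Q"
    and "\<And>n. AE \<omega> in sample_measure (lborel_on X) f0. int_lik Q f0 A n \<omega> > 0"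
    and "(\<Sum>n. ennreal (1 / (real (Suc n))\<^sup>2) *
            ext_variance (sample_measure (lborel_on X) f0)
              (\<lambda>\<omega>. ln (int_lik Q f0 A (Suc n) \<omega> / int_lik Q f0 A n \<omega>))) < \<infinity>"
    and "AE \<omega> in sample_measure (lborel_on X) f0.
           liminf (\<lambda>n. kl_div (lborel_on X) (predictive Q f0 A n \<omega>) f0) > 0"
  shows "AE \<omega> in sample_measure (lborel_on X) f0.
           (\<lambda>n. posterior Q f0 n \<omega> A) \<longlonglongrightarrow> 0"
proof -
  interpret bayesian_model "lborel_on X" f0 Q
    using assms(2,3) by unfold_locales
  show ?thesis
    using posterior_tendsto_zero[OF assms(4,5)] assms(6-8) unfolding sample_measure_eq by blast
qed

end
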